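(* Let $(G,S)$ be a Coxeter system with $S=\{s_0,\dots,s_{n-1}\}$ and Coxeter matrix $\mathfrak{m}=(m_{ij})_{0\le i,j\le n-1}$, let $\mathcal{G}$ be its Coxeter graph and $\mathcal{G}^c$ a connected extension of $\mathcal{G}$, and let $\tilde{G}^+$ be the associated extension of the alternating subgroup $G^+$ (defined in the context). For every edge of $\mathcal{G}^c$ (virtual or not) with endpoints $i<j$, oriented from $i$ to $j$, introduce a generator $\tilde{r}_{ij}$, and write $\tilde{r}_{ji}:=\tilde{r}_{ij}^{-1}$. Then $\tilde{G}^+$ is isomorphic to the group generated by the $\tilde{r}_{ij}$ and $z$ with the defining relations $$\left\{\begin{array}{ll} (\tilde{r}_{ij})^{m_{ij}}=z^{m_{ij}-1} & \text{for all generators } \tilde{r}_{ij},\\ \tilde{r}_{ii_1}\tilde{r}_{i_1i_2}\cdots \tilde{r}_{i_ai}=1 & \text{for cycles of } \mathcal{G}^c \text{ with edges } (i i_1),(i_1i_2),\dots,(i_ai),\\ (\tilde{r}_{ij}\tilde{r}_{jk})^2=z & \text{for } \tilde{r}_{ij},\tilde{r}_{jk} \text{ such that } i<k \text{ and } m_{ik}=2,\\ (\tilde{r}_{ij}\tilde{r}_{jk}\tilde{r}_{kl})^2=z & \text{for } \tilde{r}_{ij},\tilde{r}_{jk},\tilde{r}_{kl} \text{ such that } i<l \text{ and } m_{il}=2,\\ \tilde{r}_{ij}\tilde{r}_{lm}=\tilde{r}_{lm}\tilde{r}_{ij} & \text{for } \tilde{r}_{ij} \text{ and } \tilde{r}_{lm}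 \text{ which are not connected,}\\ z \text{ is central and } z^2=1. \end{array}\right.$$
   Context: A Coxeter system $(G,S)$ with $S=\{s_0,\dots,s_{n-1}\}$ is given by a symmetric matrix $\mathfrak{m}=(m_{ij})_{i,j=0,\dots,n-1}$ with $m_{ii}=1$ and $m_{ij}\in\{2,3,\dots\}\cup\{\infty\}$ for $i\ne j$, and $G=\langle s_0,\dots,s_{n-1}\mid (s_is_j)^{m_{ij}}=1,\ i\le j\rangle$. In all presentations, a relation involving an exponent $m_{ij}=\infty$ is understood to be omitted. The Coxeter graph $\mathcal{G}$ has vertices $0,\dots,n-1$, with an edge between $i$ and $j$ if and only if $m_{ij}\ge 3$. The alternating subgroup is $G^+:=\ker(\epsilon)$, where $\epsilon:G\to\{-1,1\}$ is the homomorphism with $\epsilon(s_i)=-1$ for all $i$. $\tilde{G}$ is the group with generators $\tilde{s}_0,\dots,\tilde{s}_{n-1},\alpha$ and defining relations (for all $i,j$, including $i=j$): $(\tilde{s}_i\tilde{s}_j)^{m_{ij}}=1$ if $m_{ij}$ is odd; $(\tilde{s}_i\tilde{s}_j)^{m_{ij}}=\alpha$ if $m_{ij}$ is even; $\alpha$ is central and $\alpha^2=1$. Let $\pi:\tilde{G}\to G$ be the natural projection ($\tilde{s}_i\mapsto s_i$, $\alpha\mapsto 1$), and set $\tilde{G}^+:=\pi^{-1}(G^+)$. Connected extension: let $\mathcal{G}=\mathcal{G}_1\sqcup\dots\sqcup\mathcal{G}_m$ be the decomposition into connected components (numbered in any order). For $a=1,\dots,m$ choose an arbitrary vertex $i_a$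 of $\mathcal{G}_a$; then for each $l=1,\dots,m-1$ add a "virtual" edge between $i_l$ and $i_{l+1}$, labeled by $2$ (consistently with $m_{i_li_{l+1}}=2$). The resulting connected graph $\mathcal{G}^c$ is called a connected extension of $\mathcal{G}$. If $\mathcal{G}$ is connected, $\mathcal{G}^c=\mathcal{G}$. In the relations, $\tilde{r}_{ij}$ may denote either a generator (if $i<j$) or the inverse of a generator (if $i>j$, $\tilde{r}_{ij}=\tilde{r}_{ji}^{-1}$); it is defined whenever $\{i,j\}$ is an edge (virtual or not) of $\mathcal{G}^c$. Two generators $\tilde{r}_{ij}$ and $\tilde{r}_{lm}$ are said to be not connected if $\{i,j\}\cap\{l,m\}=\varnothing$ and there is no edge or virtual edge of $\mathcal{G}^c$ connecting any of the vertices $i,j$ with any of the vertices $l,m$. *)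

theory Defs
  imports "HOL-Algebra.Sym_Groups" "HOL-Library.Extended_Nat"
begin

section \<open>Group presentations\<close>

text \<open>A word is a list of signed generators: \<open>(x, True)\<close> stands for \<open>x\<close> and \<open>(x, False)\<close>
  for its formal inverse. A relation \<open>u = v\<close> is the pair \<open>(u, v)\<close> of words.\<close>

type_synonym 'x word = "('x \<times> bool) list"

definition words :: "'x set \<Rightarrow> 'x word set" where
  "words X = lists (X \<times> UNIV)"

definition gen :: "'x \<Rightarrow> 'x word" where
  "gen x = [(x, True)]"

definition gen_inv :: "'x \<Rightarrow> 'x word" where
  "gen_inv x = [(x, False)]"

definition word_pow :: "'x word \<Rightarrow> nat \<Rightarrow> 'x word" where
  "word_pow w k = concat (replicate k w)"

text \<open>The congruence on words over \<open>X\<close> generated by free cancellation and by \<open>R\<close>. Pairs in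
  \<open>R\<close> that are not words over \<open>X\<close> would be ignored; the lemmas \<open>coxeter_rels_words\<close>,
  \<open>cover_rels_words\<close> and \<open>edge_rels_words\<close> show that this never happens below.\<close>

inductive pres_eq :: "'x set \<Rightarrow> ('x word \<times> 'x word) set \<Rightarrow> 'x word \<Rightarrow> 'x word \<Rightarrow> bool"
  for X R where
  pres_eq_refl: "w \<in> words X \<Longrightarrow> pres_eq X R w w"
| pres_eq_sym: "pres_eq X R u v \<Longrightarrow> pres_eq X R v u"
| pres_eq_trans: "pres_eq X R u v \<Longrightarrow> pres_eq X R v w \<Longrightarrow> pres_eq X R u w"
| pres_eq_append: "pres_eq X R u v \<Longrightarrow> pres_eq X R u' v' \<Longrightarrow> pres_eq X R (u @ u') (v @ v')"
| pres_eq_cancel: "x \<in> X \<Longrightarrow> pres_eq X R [(x, b), (x, \<not> b)] []"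
| pres_eq_rel: "(u, v) \<in> R \<Longrightarrow> u \<in> words X \<Longrightarrow> v \<in> words X \<Longrightarrow> pres_eq X R u v"

definition word_class :: "'x set \<Rightarrow> ('x word \<times> 'x word) set \<Rightarrow> 'x word \<Rightarrow> 'x word set" where
  "word_class X R w = {v. pres_eq X R w v}"

definition presented_group :: "'x set \<Rightarrow> ('x word \<times> 'x word) set \<Rightarrow> 'x word set monoid" where
  "presented_group X R =
    \<lparr>carrier = word_class X R ` words X,
     mult = (\<lambda>A B. \<Union>u\<in>A. \<Union>v\<in>B. word_class X R (u @ v)),
     one = word_class X R []\<rparr>"

fun word_eval :: "('h, 'b) monoid_scheme \<Rightarrow> ('x \<Rightarrow> 'h) \<Rightarrow> 'x word \<Rightarrow> 'h" where
  "word_eval H f [] = \<one>\<^bsub>H\<^esub>"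
| "word_eval H f ((x, b) # w) = (if b then f x else inv\<^bsub>H\<^esub> (f x)) \<otimes>\<^bsub>H\<^esub> word_eval H f w"

text \<open>The homomorphism from a presented group to \<open>H\<close> that sends each generator \<open>x\<close> to \<open>f x\<close>;
  meaningful when \<open>f\<close> respects the relations (lemma \<open>pres_hom_hom\<close>).\<close>

definition pres_hom :: "('h, 'b) monoid_scheme \<Rightarrow> ('x \<Rightarrow> 'h) \<Rightarrow> 'x word set \<Rightarrow> 'h" where
  "pres_hom H f C = the_elem (word_eval H f ` C)"

lemma words_Nil [simp]: "[] \<in> words X"
  and words_Cons [simp]: "(a # w) \<in> words X \<longleftrightarrow> fst a \<in> X \<and> w \<in> words X"
  and words_append [simp]: "(u @ v) \<in> words X \<longleftrightarrow> u \<in> words X \<and> v \<in> words X"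
  by (cases a; auto simp: words_def)+

lemma words_pow [simp]: "w \<in> words X \<Longrightarrow> word_pow w k \<in> words X"
  by (induction k) (auto simp: word_pow_def)

lemma pres_eq_words: "pres_eq X R u v \<Longrightarrow> u \<in> words X \<and> v \<in> words X"
  by (induction rule: pres_eq.induct) auto

lemma word_class_eq: "pres_eq X R u v \<Longrightarrow> word_class X R u = word_class X R v"
  unfolding word_class_def by (auto intro: pres_eq_trans pres_eq_sym)

lemma self_in_word_class: "w \<in> words X \<Longrightarrow> w \<in> word_class X R w"
  by (simp add: word_class_def pres_eq_refl)

lemma word_class_closed: "w \<in> words X \<Longrightarrow> word_class X R w \<in> carrier (presented_group X R)"
  by (simp add: presented_group_def)

lemma presented_mult:
  assumes "u \<in> words X" "v \<in> words X"
  shows "word_class X R u \<otimes>\<^bsub>presented_group X R\<^esub> word_class X R v = word_class X R (u @ v)"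
proof -
  have eq: "word_class X R (u' @ v') = word_class X R (u @ v)"
    if "u' \<in> word_class X R u" "v' \<in> word_class X R v" for u' v'
    using that by (intro word_class_eq[symmetric] pres_eq_append) (simp_all add: word_class_def)
  have "(\<Union>u'\<in>word_class X R u. \<Union>v'\<in>word_class X R v. word_class X R (u' @ v'))
      = (\<Union>u'\<in>word_class X R u. \<Union>v'\<in>word_class X R v. word_class X R (u @ v))"
    by (intro SUP_cong[OF refl]) (rule eq)
  also have "\<dots> = word_class X R (u @ v)"
    using self_in_word_class[of u X R] self_in_word_class[of v X R] assms by auto
  finally show ?thesis
    by (simp add: presented_group_def)
qed

lemma presented_inverse:
  assumes "w \<in> words X"
  shows "\<exists>v\<in>words X. pres_eq X R (v @ w) []"
  using assms
proof (induction w)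
  case Nil
  then show ?case by (auto intro!: bexI[of _ "[]"] pres_eq_refl)
next
  case (Cons a w)
  obtain x b where a: "a = (x, b)" by force
  from Cons obtain v where v: "v \<in> words X" "pres_eq X R (v @ w) []" and x: "x \<in> X" and w: "w \<in> words X"
    using a by auto
  have "pres_eq X R ([(x, \<not> b), (x, b)] @ w) ([] @ w)"
    using pres_eq_append[OF pres_eq_cancel[of x X R "\<not> b"] pres_eq_refl] x w by simp
  then have "pres_eq X R (v @ ([(x, \<not> b), (x, b)] @ w)) (v @ ([] @ w))"
    by (rule pres_eq_append[OF pres_eq_refl[OF v(1)]])
  then have "pres_eq X R ((v @ [(x, \<not> b)]) @ (a # w)) []"
    using v a by (auto intro: pres_eq_trans)
  then show ?case using v(1) x by (intro bexI[of _ "v @ [(x, \<not> b)]"]) auto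
qed

lemma presented_group_group: "group (presented_group X R)" (is "group ?P")
proof (rule groupI)
  have car: "carrier ?P = word_class X R ` words X" and one: "\<one>\<^bsub>?P\<^esub> = word_class X R []"
    by (simp_all add: presented_group_def)
  show "\<one>\<^bsub>?P\<^esub> \<in> carrier ?P" using car one by auto
  fix a assume "a \<in> carrier ?P"
  then obtain u where u: "u \<in> words X" "a = word_class X R u" using car by auto
  show "\<one>\<^bsub>?P\<^esub> \<otimes>\<^bsub>?P\<^esub> a = a" using u one by (simp add: presented_mult)
  show "\<exists>y\<in>carrier ?P. y \<otimes>\<^bsub>?P\<^esub> a = \<one>\<^bsub>?P\<^esub>"
  proof -
    obtain v where "v \<in> words X" "pres_eq X R (v @ u) []"
      using presented_inverse[OF u(1)] by auto
    then have "word_class X R v \<otimes>\<^bsub>?P\<^esub> a = \<one>\<^bsub>?P\<^esub>" "word_class X R v \<in> carrier ?P"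
      using u one car by (auto simp: presented_mult word_class_eq)
    then show ?thesis by auto
  qed
  fix b assume "b \<in> carrier ?P"
  then obtain v where v: "v \<in> words X" "b = word_class X R v" using car by auto
  show "a \<otimes>\<^bsub>?P\<^esub> b \<in> carrier ?P" using u v car by (simp add: presented_mult)
  fix c assume "c \<in> carrier ?P"
  then obtain w where w: "w \<in> words X" "c = word_class X R w" using car by auto
  show "a \<otimes>\<^bsub>?P\<^esub> b \<otimes>\<^bsub>?P\<^esub> c = a \<otimes>\<^bsub>?P\<^esub> (b \<otimes>\<^bsub>?P\<^esub> c)"
    using u v w by (simp add: presented_mult)
qed

lemma presented_pow:
  assumes "w \<in> words X"
  shows "word_class X R w [^]\<^bsub>presented_group X R\<^esub> (k::nat) = word_class X R (word_pow w k)"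
proof -
  interpret group "presented_group X R" by (rule presented_group_group)
  show ?thesis
  proof (induction k)
    case 0
    then show ?case by (simp add: word_pow_def) (simp add: presented_group_def)
  next
    case (Suc k)
    have "word_pow w (Suc k) = word_pow w k @ w"
      by (induction k) (simp_all add: word_pow_def)
    then show ?case using Suc assms by (simp add: presented_mult)
  qed
qed

context group
begin

lemma word_eval_closed:
  "f \<in> X \<rightarrow> carrier G \<Longrightarrow> w \<in> words X \<Longrightarrow> word_eval G f w \<in> carrier G"
  by (induction w) (auto simp: Pi_iff)

lemma word_eval_append:
  "f \<in> X \<rightarrow> carrier G \<Longrightarrow> u \<in> words X \<Longrightarrow> v \<in> words X \<Longrightarrow>
    word_eval G f (u @ v) = word_eval G f u \<otimes> word_eval G f v"
  by (induction u) (auto simp: word_eval_closed m_assoc Pi_iff)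

lemma word_eval_pow:
  assumes "f \<in> X \<rightarrow> carrier G" "w \<in> words X"
  shows "word_eval G f (word_pow w k) = word_eval G f w [^] k"
proof (induction k)
  case (Suc k)
  have "word_pow w (Suc k) = w @ word_pow w k" by (simp add: word_pow_def)
  then show ?case
    using Suc assms
    by (metis nat_pow_Suc2 word_eval_append word_eval_closed words_pow)
qed (simp add: word_pow_def)

lemma word_eval_pres_eq:
  assumes f: "f \<in> X \<rightarrow> carrier G"
    and R: "\<And>u v. (u, v) \<in> R \<Longrightarrow> word_eval G f u = word_eval G f v"
    and "pres_eq X R u v"
  shows "word_eval G f u = word_eval G f v"
  using assms(3)
proof (induction rule: pres_eq.induct)
  case (pres_eq_append u v u' v')
  then show ?case using f by (metis pres_eq_words word_eval_append)
next
  case (pres_eq_cancel x b)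
  then show ?case using f by (cases b) (auto simp: Pi_iff)
qed (auto simp: R)

lemma pres_hom_class:
  assumes "f \<in> X \<rightarrow> carrier G"
    and "\<And>u v. (u, v) \<in> R \<Longrightarrow> word_eval G f u = word_eval G f v"
    and "w \<in> words X"
  shows "pres_hom G f (word_class X R w) = word_eval G f w"
proof -
  have "word_eval G f ` word_class X R w = {word_eval G f w}"
    using self_in_word_class[OF assms(3)] word_eval_pres_eq[OF assms(1,2)]
    unfolding word_class_def by fastforce
  then show ?thesis by (simp add: pres_hom_def)
qed

lemma pres_hom_hom:
  assumes "f \<in> X \<rightarrow> carrier G"
    and "\<And>u v. (u, v) \<in> R \<Longrightarrow> word_eval G f u = word_eval G f v"
  shows "pres_hom G f \<in> hom (presented_group X R) G"
proof (rule homI)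
  fix a b assume "a \<in> carrier (presented_group X R)" "b \<in> carrier (presented_group X R)"
  then obtain u v where "u \<in> words X" "a = word_class X R u" "v \<in> words X" "b = word_class X R v"
    by (auto simp: presented_group_def)
  then show "pres_hom G f a \<in> carrier G"
    "pres_hom G f (a \<otimes>\<^bsub>presented_group X R\<^esub> b) = pres_hom G f a \<otimes> pres_hom G f b"
    using assms by (simp_all add: presented_mult pres_hom_class word_eval_append word_eval_closed)
qed

end


section \<open>Coxeter groups and the extension of the alternating subgroup\<close>

definition coxeter_matrix :: "nat \<Rightarrow> (nat \<Rightarrow> nat \<Rightarrow> enat) \<Rightarrow> bool" where
  "coxeter_matrix n m \<longleftrightarrow>
    (\<forall>i<n. \<forall>j<n. m i j = m j i) \<and> (\<forall>i<n. m i i = 1) \<and> (\<forall>i<n. \<forall>j<n. i \<noteq> j \<longrightarrow> 2 \<le> m i j)"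

text \<open>Requiring \<open>m i j = enat k\<close> omits the relations with infinite exponent.\<close>

definition coxeter_rels :: "nat \<Rightarrow> (nat \<Rightarrow> nat \<Rightarrow> enat) \<Rightarrow> (nat word \<times> nat word) set" where
  "coxeter_rels n m =
    {(word_pow (gen i @ gen j) k, []) | i j k. i \<le> j \<and> j < n \<and> m i j = enat k}"

definition coxeter_group :: "nat \<Rightarrow> (nat \<Rightarrow> nat \<Rightarrow> enat) \<Rightarrow> nat word set monoid" where
  "coxeter_group n m = presented_group {..<n} (coxeter_rels n m)"

definition coxeter_gen :: "nat \<Rightarrow> (nat \<Rightarrow> nat \<Rightarrow> enat) \<Rightarrow> nat \<Rightarrow> nat word set" where
  "coxeter_gen n m i = word_class {..<n} (coxeter_rels n m) (gen i)"

definition coxeter_sign :: "nat word set \<Rightarrow> int" where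
  "coxeter_sign = pres_hom sign_img (\<lambda>i. - 1)"

definition alternating_subgroup :: "nat \<Rightarrow> (nat \<Rightarrow> nat \<Rightarrow> enat) \<Rightarrow> nat word set set" where
  "alternating_subgroup n m = kernel (coxeter_group n m) sign_img coxeter_sign"

datatype cover_generator = STilde nat | Alpha

definition cover_gens :: "nat \<Rightarrow> cover_generator set" where
  "cover_gens n = STilde ` {..<n} \<union> {Alpha}"

definition cover_rels ::
    "nat \<Rightarrow> (nat \<Rightarrow> nat \<Rightarrow> enat) \<Rightarrow> (cover_generator word \<times> cover_generator word) set" where
  "cover_rels n m =
     {(word_pow (gen (STilde i) @ gen (STilde j)) k, []) | i j k.
        i < n \<and> j < n \<and> m i j = enat k \<and> odd k}
   \<union> {(word_pow (gen (STilde i) @ gen (STilde j)) k, gen Alpha) | i j k.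
        i < n \<and> j < n \<and> m i j = enat k \<and> even k}
   \<union> {(gen Alpha @ gen (STilde i), gen (STilde i) @ gen Alpha) | i. i < n}
   \<union> {(word_pow (gen Alpha) 2, [])}"

definition cover_group :: "nat \<Rightarrow> (nat \<Rightarrow> nat \<Rightarrow> enat) \<Rightarrow> cover_generator word set monoid" where
  "cover_group n m = presented_group (cover_gens n) (cover_rels n m)"

fun cover_proj_gen :: "nat \<Rightarrow> (nat \<Rightarrow> nat \<Rightarrow> enat) \<Rightarrow> cover_generator \<Rightarrow> nat word set" where
  "cover_proj_gen n m (STilde i) = coxeter_gen n m i"
| "cover_proj_gen n m Alpha = \<one>\<^bsub>coxeter_group n m\<^esub>"

definition cover_proj ::
    "nat \<Rightarrow> (nat \<Rightarrow> nat \<Rightarrow> enat) \<Rightarrow> cover_generator word set \<Rightarrow> nat word set" where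
  "cover_proj n m = pres_hom (coxeter_group n m) (cover_proj_gen n m)"

definition cover_alternating ::
    "nat \<Rightarrow> (nat \<Rightarrow> nat \<Rightarrow> enat) \<Rightarrow> cover_generator word set monoid" where
  "cover_alternating n m =
    (cover_group n m)
      \<lparr>carrier := {x \<in> carrier (cover_group n m). cover_proj n m x \<in> alternating_subgroup n m}\<rparr>"


section \<open>Connected extensions of the Coxeter graph\<close>

definition coxeter_edges :: "nat \<Rightarrow> (nat \<Rightarrow> nat \<Rightarrow> enat) \<Rightarrow> nat set set" where
  "coxeter_edges n m = {{i, j} | i j. i < n \<and> j < n \<and> i \<noteq> j \<and> 3 \<le> m i j}"

definition coxeter_components :: "nat \<Rightarrow> (nat \<Rightarrow> nat \<Rightarrow> enat) \<Rightarrow> nat set set" where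
  "coxeter_components n m =
    {..<n} // {(i, j). i < n \<and> j < n \<and> (i, j) \<in> {(k, l). {k, l} \<in> coxeter_edges n m}\<^sup>*}"

text \<open>\<open>Cs\<close> is the chosen numbering of the components, \<open>vs\<close> the list of chosen vertices.\<close>

definition connected_extension ::
    "nat \<Rightarrow> (nat \<Rightarrow> nat \<Rightarrow> enat) \<Rightarrow> nat set set \<Rightarrow> bool" where
  "connected_extension n m E \<longleftrightarrow>
    (\<exists>Cs vs. distinct Cs \<and> set Cs = coxeter_components n m \<and>
       length vs = length Cs \<and> (\<forall>a<length Cs. vs ! a \<in> Cs ! a) \<and>
       E = coxeter_edges n m \<union> {{vs ! l, vs ! Suc l} | l. Suc l < length vs})"

text \<open>A cycle is given by its list of pairwise different vertices, the last of which is adjacent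
  to the first.\<close>

definition graph_cycle :: "'v set set \<Rightarrow> 'v list \<Rightarrow> bool" where
  "graph_cycle E vs \<longleftrightarrow>
    distinct vs \<and> 3 \<le> length vs \<and> (\<forall>(x, y) \<in> set (zip vs (rotate1 vs)). {x, y} \<in> E)"

definition not_connected :: "nat set set \<Rightarrow> nat set \<Rightarrow> nat set \<Rightarrow> bool" where
  "not_connected E e f \<longleftrightarrow> e \<inter> f = {} \<and> (\<forall>x\<in>e. \<forall>y\<in>f. {x, y} \<notin> E)"


section \<open>The presentation by the edges of a connected extension\<close>

datatype edge_generator = RTilde nat nat | ZGen

definition edge_gens :: "nat set set \<Rightarrow> edge_generator set" where
  "edge_gens E = {RTilde i j | i j. i < j \<and> {i, j} \<in> E} \<union> {ZGen}"

definition edge_word :: "nat \<Rightarrow> nat \<Rightarrow> edge_generator word" where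
  "edge_word i j = (if i < j then gen (RTilde i j) else gen_inv (RTilde j i))"

definition edge_rels ::
    "(nat \<Rightarrow> nat \<Rightarrow> enat) \<Rightarrow> nat set set \<Rightarrow> (edge_generator word \<times> edge_generator word) set" where
  "edge_rels m E =
     {(word_pow (edge_word i j) k, word_pow (gen ZGen) (k - 1)) | i j k.
        i < j \<and> {i, j} \<in> E \<and> m i j = enat k}
   \<union> {(concat (map2 edge_word vs (rotate1 vs)), []) | vs. graph_cycle E vs}
   \<union> {(word_pow (edge_word i j @ edge_word j k) 2, gen ZGen) | i j k.
        {i, j} \<in> E \<and> {j, k} \<in> E \<and> i < k \<and> m i k = 2}
   \<union> {(word_pow (edge_word i j @ edge_word j k @ edge_word k l) 2, gen ZGen) | i j k l.
        {i, j} \<in> E \<and> {j, k} \<in> E \<and> {k, l} \<in> E \<and> i < l \<and> m i l = 2}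
   \<union> {(edge_word i j @ edge_word k l, edge_word k l @ edge_word i j) | i j k l.
        {i, j} \<in> E \<and> {k, l} \<in> E \<and> not_connected E {i, j} {k, l}}
   \<union> {(gen ZGen @ edge_word i j, edge_word i j @ gen ZGen) | i j. i < j \<and> {i, j} \<in> E}
   \<union> {(word_pow (gen ZGen) 2, [])}"

definition edge_group ::
    "(nat \<Rightarrow> nat \<Rightarrow> enat) \<Rightarrow> nat set set \<Rightarrow> edge_generator word set monoid" where
  "edge_group m E = presented_group (edge_gens E) (edge_rels m E)"


section \<open>Well-definedness\<close>

lemma coxeter_rels_words: "coxeter_rels n m \<subseteq> words {..<n} \<times> words {..<n}"
  by (auto simp: coxeter_rels_def gen_def)

lemma cover_rels_words: "cover_rels n m \<subseteq> words (cover_gens n) \<times> words (cover_gens n)"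
  by (auto simp: cover_rels_def gen_def cover_gens_def)

lemma connected_extension_edge:
  assumes "connected_extension n m E" "e \<in> E"
  obtains i j where "e = {i, j}" "i < j" "j < n"
proof -
  let ?Q = "{(i, j). i < n \<and> j < n \<and> (i, j) \<in> {(k, l). {k, l} \<in> coxeter_edges n m}\<^sup>*}"
  let ?A = "{(k, l). {k, l} \<in> coxeter_edges n m}"
  have "sym (?A\<^sup>*)"
    by (intro sym_rtrancl) (auto simp: sym_def insert_commute)
  then have eq: "equiv {..<n} ?Q"
    by (intro equivI refl_onI symI transI) (auto dest: symD intro: rtrancl_trans)
  obtain Cs vs where C: "distinct Cs" "set Cs = {..<n} // ?Q" "length vs = length Cs"
      "\<And>a. a < length Cs \<Longrightarrow> vs ! a \<in> Cs ! a"
      and E: "E = coxeter_edges n m \<union> {{vs ! l, vs ! Suc l} | l. Suc l < length vs}"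
    using assms(1) unfolding connected_extension_def coxeter_components_def by auto
  have "\<exists>i j. e = {i, j} \<and> i \<noteq> j \<and> i < n \<and> j < n"
  proof (cases "e \<in> coxeter_edges n m")
    case True
    then show ?thesis by (auto simp: coxeter_edges_def)
  next
    case False
    then obtain l where l: "e = {vs ! l, vs ! Suc l}" "Suc l < length Cs"
      using assms(2) E C by auto
    then have mem: "Cs ! l \<in> {..<n} // ?Q" "Cs ! Suc l \<in> {..<n} // ?Q"
      using C(2) by (metis Suc_lessD nth_mem)+
    have "Cs ! l \<noteq> Cs ! Suc l" using C(1) l by (simp add: nth_eq_iff_index_eq)
    then have "Cs ! l \<inter> Cs ! Suc l = {}" using quotient_disj[OF eq mem] by simp
    moreover have "vs ! l \<in> Cs ! l" "vs ! Suc l \<in> Cs ! Suc l" using C(4) l by auto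
    moreover have "Cs ! l \<subseteq> {..<n}" "Cs ! Suc l \<subseteq> {..<n}"
      using mem by (auto simp: quotient_def)
    ultimately have "vs ! l \<noteq> vs ! Suc l" "vs ! l < n" "vs ! Suc l < n" by auto
    then show ?thesis using l(1) by blast
  qed
  then obtain i j where ij: "e = {i, j}" "i \<noteq> j" "i < n" "j < n" by blast
  then show thesis using that[of i j] that[of j i] by (cases "i < j") auto
qed

lemma edge_word_words:
  assumes "connected_extension n m E" "{i, j} \<in> E"
  shows "edge_word i j \<in> words (edge_gens E)"
proof -
  have "i \<noteq> j"
    by (rule connected_extension_edge[OF assms]) (auto simp: doubleton_eq_iff)
  moreover have "{j, i} \<in> E" using assms(2) by (simp add: insert_commute)
  ultimately show ?thesis
    using assms(2) by (auto simp: edge_word_def gen_def gen_inv_def edge_gens_def)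
qed

lemma edge_rels_words:
  assumes "connected_extension n m E"
  shows "edge_rels m E \<subseteq> words (edge_gens E) \<times> words (edge_gens E)"
proof -
  have Z: "gen ZGen \<in> words (edge_gens E)" by (simp add: gen_def edge_gens_def)
  have "concat (map2 edge_word us vs) \<in> words (edge_gens E)"
    if "\<forall>(x, y) \<in> set (zip us vs). {x, y} \<in> E" for us vs
    using that
  proof (induction us arbitrary: vs)
    case (Cons x us)
    then show ?case by (cases vs) (auto intro: edge_word_words[OF assms])
  qed simp
  then have "concat (map2 edge_word vs (rotate1 vs)) \<in> words (edge_gens E)" if "graph_cycle E vs" for vs
    using that unfolding graph_cycle_def by blast
  then show ?thesis
    unfolding edge_rels_def using Z edge_word_words[OF assms] by auto
qed

lemma sign_img_power: "x [^]\<^bsub>sign_img\<^esub> (k::nat) = x ^ k"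
  by (induction k) (simp_all add: nat_pow_def sign_img_def)

lemma coxeter_sign_rels:
  assumes "(u, v) \<in> coxeter_rels n m"
  shows "word_eval sign_img (\<lambda>i. - 1) u = word_eval sign_img (\<lambda>i. - 1) v"
proof -
  obtain i j k where uv: "u = word_pow (gen i @ gen j) k" "v = []"
    using assms by (auto simp: coxeter_rels_def)
  have "word_eval sign_img (\<lambda>i. - 1) u = word_eval sign_img (\<lambda>i. - 1) (gen i @ gen j) ^ k"
    unfolding uv sign_img_power[symmetric]
    by (rule group.word_eval_pow[OF sign_img_is_group, where X = UNIV])
       (auto simp: sign_img_def gen_def)
  also have "word_eval sign_img (\<lambda>i. - 1) (gen i @ gen j) = 1"
    by (simp add: sign_img_def gen_def)
  finally show ?thesis by (simp add: uv sign_img_def)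
qed

lemma coxeter_sign_hom: "coxeter_sign \<in> hom (coxeter_group n m) sign_img"
  unfolding coxeter_sign_def coxeter_group_def
  by (rule group.pres_hom_hom[OF sign_img_is_group _ coxeter_sign_rels]) (auto simp: sign_img_def)

lemma coxeter_sign_gen: "i < n \<Longrightarrow> coxeter_sign (coxeter_gen n m i) = - 1"
  unfolding coxeter_sign_def coxeter_gen_def
  by (subst group.pres_hom_class[OF sign_img_is_group _ coxeter_sign_rels])
     (auto simp: sign_img_def gen_def)

lemma coxeter_group_group: "group (coxeter_group n m)"
  unfolding coxeter_group_def by (rule presented_group_group)

lemma cover_group_group: "group (cover_group n m)"
  unfolding cover_group_def by (rule presented_group_group)

lemma coxeter_gen_closed: "i < n \<Longrightarrow> coxeter_gen n m i \<in> carrier (coxeter_group n m)"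
  unfolding coxeter_group_def coxeter_gen_def
  by (rule word_class_closed) (simp add: gen_def)

lemma cover_proj_gen_closed: "cover_proj_gen n m \<in> cover_gens n \<rightarrow> carrier (coxeter_group n m)"
  using group.is_monoid[OF coxeter_group_group]
  by (auto simp: cover_gens_def coxeter_gen_closed)

lemma coxeter_relation:
  assumes "coxeter_matrix n m" "i < n" "j < n" "m i j = enat k"
  shows "(coxeter_gen n m i \<otimes>\<^bsub>coxeter_group n m\<^esub> coxeter_gen n m j) [^]\<^bsub>coxeter_group n m\<^esub> k
    = \<one>\<^bsub>coxeter_group n m\<^esub>" (is "(?s i \<otimes>\<^bsub>?G\<^esub> ?s j) [^]\<^bsub>?G\<^esub> k = _")
proof -
  interpret group ?G by (rule coxeter_group_group)
  have cl: "?s i \<in> carrier ?G" if "i < n" for i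
    using that by (rule coxeter_gen_closed)
  have le: "(?s i \<otimes>\<^bsub>?G\<^esub> ?s j) [^]\<^bsub>?G\<^esub> k = \<one>\<^bsub>?G\<^esub>"
    if ij: "i \<le> j" "j < n" "m i j = enat k" for i j k
  proof -
    let ?w = "gen i @ gen j" and ?cl = "word_class {..<n} (coxeter_rels n m)"
    have w: "?w \<in> words {..<n}" "gen i \<in> words {..<n}" "gen j \<in> words {..<n}"
      using ij by (auto simp: gen_def)
    have s: "?s i \<otimes>\<^bsub>?G\<^esub> ?s j = ?cl ?w"
      using w by (simp add: coxeter_gen_def coxeter_group_def presented_mult)
    have p: "?cl ?w [^]\<^bsub>?G\<^esub> k = ?cl (word_pow ?w k)"
      using w(1) by (simp only: coxeter_group_def presented_pow)
    have "pres_eq {..<n} (coxeter_rels n m) (word_pow ?w k) []"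
      using ij w by (intro pres_eq_rel words_pow) (auto simp: coxeter_rels_def)
    then show ?thesis
      using s p by (simp add: word_class_eq coxeter_group_def presented_group_def)
  qed
  show ?thesis
  proof (cases "i \<le> j")
    case True
    then show ?thesis using le assms by blast
  next
    case False
    have sq: "?s i \<otimes>\<^bsub>?G\<^esub> ?s i = \<one>\<^bsub>?G\<^esub>" if "i < n" for i
      using le[of i i 1] that assms(1) cl[OF that] by (simp add: coxeter_matrix_def one_enat_def)
    then have invs: "inv\<^bsub>?G\<^esub> ?s i = ?s i" if "i < n" for i
      using that cl[OF that] by (simp add: inv_equality)
    have "m j i = enat k" using assms by (metis coxeter_matrix_def)
    then have "(?s j \<otimes>\<^bsub>?G\<^esub> ?s i) [^]\<^bsub>?G\<^esub> k = \<one>\<^bsub>?G\<^esub>" using le False assms by simp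
    moreover have "?s i \<otimes>\<^bsub>?G\<^esub> ?s j = inv\<^bsub>?G\<^esub> (?s j \<otimes>\<^bsub>?G\<^esub> ?s i)"
      using assms cl by (simp add: inv_mult_group invs)
    ultimately show ?thesis
      using assms cl by (simp add: nat_pow_inv)
  qed
qed

lemma cover_proj_rels:
  assumes "coxeter_matrix n m" "(u, v) \<in> cover_rels n m"
  shows "word_eval (coxeter_group n m) (cover_proj_gen n m) u =
    word_eval (coxeter_group n m) (cover_proj_gen n m) v"
proof -
  let ?G = "coxeter_group n m"
  interpret group ?G by (rule coxeter_group_group)
  have cl: "coxeter_gen n m i \<in> carrier ?G" if "i < n" for i
    using that by (rule coxeter_gen_closed)
  have w: "gen (STilde i) @ gen (STilde j) \<in> words (cover_gens n)"
    "gen Alpha \<in> words (cover_gens n)"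
    if "i < n" "j < n" for i j using that by (auto simp: gen_def cover_gens_def)
  have a: "gen Alpha \<in> words (cover_gens n)" by (auto simp: gen_def cover_gens_def)
  have "word_eval ?G (cover_proj_gen n m) (word_pow (gen (STilde i) @ gen (STilde j)) k) = \<one>\<^bsub>?G\<^esub>"
    if "i < n" "j < n" "m i j = enat k" for i j k
    using coxeter_relation[OF assms(1) that] word_eval_pow[OF cover_proj_gen_closed w(1)[OF that(1,2)]]
      cl[OF that(1)] cl[OF that(2)]
    by (simp add: gen_def)
  moreover have "word_eval ?G (cover_proj_gen n m) (word_pow (gen Alpha) 2) = \<one>\<^bsub>?G\<^esub>"
    using word_eval_pow[OF cover_proj_gen_closed a] by (simp add: gen_def)
  ultimately show ?thesis
    using assms(2) cl unfolding cover_rels_def by (auto simp: gen_def)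
qed

lemma cover_proj_hom:
  assumes "coxeter_matrix n m"
  shows "cover_proj n m \<in> hom (cover_group n m) (coxeter_group n m)"
  unfolding cover_proj_def cover_group_def
  by (rule group.pres_hom_hom[OF coxeter_group_group cover_proj_gen_closed
        cover_proj_rels[OF assms]])

lemma cover_proj_generators:
  assumes "coxeter_matrix n m"
  shows "i < n \<Longrightarrow> cover_proj n m (word_class (cover_gens n) (cover_rels n m) (gen (STilde i)))
      = coxeter_gen n m i"
    and "cover_proj n m (word_class (cover_gens n) (cover_rels n m) (gen Alpha))
      = \<one>\<^bsub>coxeter_group n m\<^esub>"
proof -
  interpret group "coxeter_group n m" by (rule coxeter_group_group)
  have cl: "coxeter_gen n m i \<in> carrier (coxeter_group n m)" if "i < n" for i
    using that by (rule coxeter_gen_closed)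
  note * = pres_hom_class[OF cover_proj_gen_closed cover_proj_rels[OF assms]]
  show "i < n \<Longrightarrow> cover_proj n m (word_class (cover_gens n) (cover_rels n m) (gen (STilde i)))
      = coxeter_gen n m i"
    unfolding cover_proj_def by (subst *) (auto simp: gen_def cover_gens_def cl)
  show "cover_proj n m (word_class (cover_gens n) (cover_rels n m) (gen Alpha))
      = \<one>\<^bsub>coxeter_group n m\<^esub>"
    unfolding cover_proj_def by (subst *) (auto simp: gen_def cover_gens_def)
qed

end

theory Submission
  imports Defs
begin

text \<open>Write \<open>Q\<close> for the group presented by the edges of \<open>E\<close> and \<open>P\<close> for the extension of the Coxeter
  group. The isomorphism \<open>\<Phi>\<close> sends \<open>r\<^sub>i\<^sub>j\<close> to \<open>s\<^sub>i s\<^sub>j\<close> and \<open>z\<close> to \<open>\<alpha>\<close>. That it respects the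
  relations is a computation in \<open>P\<close>: products along a walk telescope because \<open>s\<^sub>i\<^sup>2 = 1\<close>, and
  \<open>s\<^sub>i s\<^sub>j = \<alpha> s\<^sub>j s\<^sub>i\<close> for non-adjacent \<open>i \<noteq> j\<close>. Its image is the even part of \<open>P\<close>, because the
  graph is connected: every \<open>s\<^sub>i s\<^sub>j\<close> is a product of images of edges along a walk from \<open>i\<close> to \<open>j\<close>.

  The substance is injectivity, that is, that the relations of \<open>Q\<close> suffice. The cycle relations make
  the product of the \<open>r\<close> along every closed walk trivial, so there are elements \<open>x\<^sub>i\<close> of \<open>Q\<close>, called
  \<open>pot i\<close> below, with \<open>r\<^sub>i\<^sub>j = x\<^sub>i\<inverse> x\<^sub>j\<close> for all edges (lemma \<open>potential_exists\<close>). For arbitrary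
  vertices put \<open>\<rho>\<^sub>i\<^sub>j = x\<^sub>i\<inverse> x\<^sub>j\<close>. The key fact is that \<open>\<rho>\<^sub>i\<^sub>j\<close> raised to the power \<open>m\<^sub>i\<^sub>j\<close> equals \<open>z\<close>
  raised to the power \<open>m\<^sub>i\<^sub>j - 1\<close> whenever the exponent is finite, for adjacent vertices or not (lemma \<open>\<rho>_power\<close>). For
  non-adjacent vertices this says \<open>\<rho>\<^sub>i\<^sub>j\<^sup>2 = z\<close>; it is a defining relation at distance two and three,
  and follows at larger distance by induction along a geodesic, whose first and last edges commute
  (lemma \<open>squares_to_z_non_edge\<close>).

  It follows that the monomial matrices with off-diagonal entries \<open>x\<^sub>i\<close> and \<open>x\<^sub>i\<inverse>\<close> satisfy the
  relations of the generators \<open>s\<^sub>i\<close> of \<open>P\<close>, with the scalar matrix \<open>z\<close> in place of \<open>\<alpha>\<close>. This gives a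
  homomorphism \<open>\<Psi>\<close> from \<open>P\<close> to the wreath product of \<open>Q\<close> with the group of order two. As
  \<open>\<Psi> (s\<^sub>i s\<^sub>j)\<close> is the diagonal matrix with entries \<open>x\<^sub>i x\<^sub>j\<inverse>\<close> and \<open>x\<^sub>i\<inverse> x\<^sub>j\<close>, the second diagonal
  entry of \<open>\<Psi> (\<Phi> q)\<close> is \<open>q\<close> (lemma \<open>\<Psi>_\<Phi>\<close>), and \<open>\<Phi>\<close> is injective. Passing to matrices avoids
  having to know beforehand that conjugation by some \<open>s\<^sub>i\<close> induces an automorphism of \<open>Q\<close>.\<close>

section \<open>Potentials of edge labellings\<close>

fun (in monoid) walk_prod :: "('v \<Rightarrow> 'v \<Rightarrow> 'a) \<Rightarrow> 'v list \<Rightarrow> 'a" where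
  "walk_prod r (x # y # vs) = r x y \<otimes> walk_prod r (y # vs)"
| "walk_prod r _ = \<one>"

lemma successively_overlap:
  "successively P (us @ v # vs) \<longleftrightarrow> successively P (us @ [v]) \<and> successively P (v # vs)"
  by (cases vs) (auto simp: successively_append_iff)

text \<open>A labelling of the oriented edges of a graph by group elements, inverted when the edge is
  reversed, whose product along every cycle is trivial. A cycle has distinct vertices; the closed
  walk that goes once around it repeats its first vertex at the end.\<close>

locale cycle_trivial_labelling = group G for G (structure) +
  fixes A :: "'v \<Rightarrow> 'v \<Rightarrow> bool" and r :: "'v \<Rightarrow> 'v \<Rightarrow> 'a"
  assumes A_sym: "A x y \<Longrightarrow> A y x"
    and A_irrefl: "\<not> A x x"
    and r_closed: "A x y \<Longrightarrow> r x y \<in> carrier G"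
    and r_rev: "A x y \<Longrightarrow> r y x = inv (r x y)"
    and r_cycle: "distinct vs \<Longrightarrow> 3 \<le> length vs \<Longrightarrow> successively A (vs @ [hd vs]) \<Longrightarrow>
      walk_prod r (vs @ [hd vs]) = \<one>"
begin

lemma walk_prod_closed: "successively A vs \<Longrightarrow> walk_prod r vs \<in> carrier G"
  by (induction vs rule: induct_list012) (auto simp: r_closed)

lemma walk_prod_join:
  "successively A (us @ v # vs) \<Longrightarrow>
    walk_prod r (us @ v # vs) = walk_prod r (us @ [v]) \<otimes> walk_prod r (v # vs)"
proof (induction us rule: induct_list012)
  case (2 x)
  then show ?case by (simp add: r_closed walk_prod_closed)
next
  case (3 x y us)
  have w: "successively A (y # us @ v # vs)" "A x y" using "3.prems" by auto
  moreover have "successively A (v # vs)" "successively A (y # us @ [v])"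
    using w successively_overlap[of A "y # us" v vs] by simp_all
  ultimately show ?case using "3.IH"(2) by (simp add: r_closed walk_prod_closed m_assoc)
qed (simp add: walk_prod_closed)

lemma successively_rev_A: "successively A (rev vs) \<longleftrightarrow> successively A vs"
proof -
  have "(\<lambda>x y. A y x) = A" using A_sym by blast
  from arg_cong[OF this, of "\<lambda>B. successively B vs"] show ?thesis by (simp add: successively_rev)
qed

lemma walk_prod_rev:
  "successively A vs \<Longrightarrow> walk_prod r (rev vs) = inv (walk_prod r vs)"
proof (induction vs rule: induct_list012)
  case (3 x y vs)
  then have w: "successively A (rev vs @ y # [x])"
    using successively_rev_A[of "x # y # vs"] by simp
  have "walk_prod r (rev vs @ y # [x]) = walk_prod r (rev vs @ [y]) \<otimes> walk_prod r [y, x]"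
    using w by (rule walk_prod_join)
  also have "\<dots> = inv (walk_prod r (y # vs)) \<otimes> inv (r x y)"
    using 3 by (simp add: r_closed r_rev[of x y])
  also have "\<dots> = inv (r x y \<otimes> walk_prod r (y # vs))"
    using 3 by (simp add: r_closed inv_mult_group walk_prod_closed)
  finally show ?case by simp
qed simp_all

text \<open>A closed walk of positive length either goes once around a cycle, or goes back and forth along one
  edge, or repeats a vertex; in the last case it is a shorter closed walk with another one inserted,
  and induction on the length applies to both.\<close>

lemma closed_walk_trivial:
  "successively A vs \<Longrightarrow> vs \<noteq> [] \<Longrightarrow> hd vs = last vs \<Longrightarrow> walk_prod r vs = \<one>"
proof (induction "length vs" arbitrary: vs rule: less_induct)
  case less
  show ?case
  proof (cases "tl vs = []")
    case True
    then show ?thesis using less.prems(2) by (cases vs) auto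
  next
    case False
    then obtain x us where vs: "vs = x # us @ [x]"
      using less.prems(2,3) by (cases vs; cases "tl vs" rule: rev_cases) auto
    show ?thesis
    proof (cases "distinct (x # us)")
      case True
      show ?thesis
      proof (cases "3 \<le> length (x # us)")
        case True
        then show ?thesis using \<open>distinct (x # us)\<close> r_cycle[of "x # us"] less.prems(1) vs by simp
      next
        case False
        then obtain y where "us = [y]"
        proof -
          have "us \<noteq> []" using less.prems(1) vs A_irrefl[of x] by auto
          moreover have "length us \<le> 1" using False by simp
          ultimately show thesis using that by (cases us) auto
        qed
        then show ?thesis using less.prems(1) vs by (simp add: r_closed r_rev[of x y])
      qed
    next
      case False
      then obtain xs y ys zs where d: "x # us = xs @ [y] @ ys @ [y] @ zs"
        using not_distinct_decomp by blast
      then have vs': "vs = xs @ y # (ys @ y # zs @ [x])" using vs by simp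
      have w: "successively A (xs @ y # (ys @ y # zs @ [x]))"
        using less.prems(1) vs' by simp
      then have w1: "successively A ((y # ys) @ y # zs @ [x])"
        and xy: "successively A (xs @ [y])"
        using successively_overlap[of A xs y "ys @ y # zs @ [x]"] by simp_all
      then have w2: "successively A (y # ys @ [y])" and yx: "successively A (y # zs @ [x])"
        using successively_overlap[of A "y # ys" y "zs @ [x]"] by simp_all
      have w3: "successively A (xs @ y # zs @ [x])"
        using successively_overlap[of A xs y "zs @ [x]"] xy yx by simp
      \<comment> \<open>The closed walk from \<open>y\<close> to its next occurrence is cut out.\<close>
      have in1: "walk_prod r (y # ys @ [y]) = \<one>"
        by (rule less.hyps[OF _ w2]) (auto simp: vs')
      have out: "walk_prod r (xs @ y # zs @ [x]) = \<one>"
      proof (rule less.hyps[OF _ w3])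
        show "hd (xs @ y # zs @ [x]) = last (xs @ y # zs @ [x])"
          using d by (cases xs) auto
      qed (auto simp: vs')
      have cl: "walk_prod r (y # zs @ [x]) \<in> carrier G"
        using yx by (rule walk_prod_closed)
      have "walk_prod r vs = walk_prod r (xs @ [y]) \<otimes> walk_prod r (y # ys @ y # zs @ [x])"
        unfolding vs' by (rule walk_prod_join[OF w])
      also have "walk_prod r (y # ys @ y # zs @ [x]) = walk_prod r (y # zs @ [x])"
        using walk_prod_join[OF w1] in1 cl by simp
      also have "walk_prod r (xs @ [y]) \<otimes> walk_prod r (y # zs @ [x]) = \<one>"
        using walk_prod_join[OF w3] out by simp
      finally show ?thesis .
    qed
  qed
qed

lemma walk_prod_unique:
  assumes p: "successively A (us @ [v])" and q: "successively A (us' @ [v])"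
    and h: "hd (us @ [v]) = hd (us' @ [v])"
  shows "walk_prod r (us @ [v]) = walk_prod r (us' @ [v])"
proof -
  let ?q = "us' @ [v]"
  have w: "successively A (us @ v # rev us')"
    using p q successively_rev_A[of ?q] successively_overlap[of A us v "rev us'"] by simp
  have "hd (us @ v # rev us') = last (us @ v # rev us')"
    using h by (cases us; cases us') (auto simp: last_rev)
  then have "walk_prod r (us @ v # rev us') = \<one>"
    using closed_walk_trivial[OF w] by simp
  then have "walk_prod r (us @ [v]) \<otimes> inv (walk_prod r ?q) = \<one>"
    using walk_prod_join[OF w] walk_prod_rev[OF q] by simp
  then show ?thesis
    using inv_equality[of "walk_prod r (us @ [v])" "inv (walk_prod r ?q)"] p q
    by (simp add: walk_prod_closed)
qed

lemma walk_exists: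
  assumes "A\<^sup>*\<^sup>* b v"
  shows "\<exists>us. successively A (us @ [v]) \<and> hd (us @ [v]) = b"
  using assms
proof (induction rule: rtranclp_induct)
  case base
  show ?case by (intro exI[of _ "[]"]) simp
next
  case (step v w)
  then obtain us where "successively A (us @ [v])" "hd (us @ [v]) = b" by blast
  then show ?case using step(2)
    by (intro exI[of _ "us @ [v]"]) (auto simp: successively_append_iff hd_append split: if_splits)
qed

text \<open>Multiplying the labels along any walk from the base point \<open>b\<close> to \<open>v\<close> gives the potential at \<open>v\<close>,
  independently of the walk.\<close>

lemma potential_exists:
  obtains x where "\<And>v. A\<^sup>*\<^sup>* b v \<Longrightarrow> x v \<in> carrier G"
    and "\<And>v w. A\<^sup>*\<^sup>* b v \<Longrightarrow> A v w \<Longrightarrow> r v w = inv (x v) \<otimes> x w"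
proof -
  obtain p where p: "successively A (p v @ [v])" "hd (p v @ [v]) = b" if "A\<^sup>*\<^sup>* b v" for v
    using walk_exists by metis
  let ?x = "\<lambda>v. walk_prod r (p v @ [v])"
  have step: "r v w = inv (?x v) \<otimes> ?x w" if v: "A\<^sup>*\<^sup>* b v" and e: "A v w" for v w
  proof -
    have w: "A\<^sup>*\<^sup>* b w" using v e by simp
    have vw: "successively A (p v @ v # [w])"
      using p[OF v] e by (auto simp: successively_append_iff)
    have "?x w = walk_prod r ((p v @ [v]) @ [w])"
      using p[OF v] p[OF w] vw by (intro walk_prod_unique) (auto simp: hd_append)
    also have "\<dots> = ?x v \<otimes> r v w"
      using walk_prod_join[OF vw] e by (simp add: r_closed)
    finally show ?thesis
      using e p[OF v] by (simp add: m_assoc[symmetric] r_closed walk_prod_closed)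
  qed
  show thesis
    by (rule that[of ?x]) (use p step walk_prod_closed in blast)+
qed

end

section \<open>Auxiliary identities in groups\<close>

text \<open>The induction step for \<open>\<rho>\<^sub>i\<^sub>j\<^sup>2 = z\<close>: here \<open>a\<close> and \<open>b\<close> stand for the first and the last edge of a
  geodesic and \<open>c\<close> for the part between them. Commuting \<open>a\<close> with \<open>b\<close> turns \<open>acbacb\<close> into
  \<open>acabcb = (ac)\<^sup>2 c\<^sup>-\<^sup>2 (cb)\<^sup>2\<close>.\<close>

lemma (in group) square_of_triple_product:
  assumes cl: "a \<in> carrier G" "b \<in> carrier G" "c \<in> carrier G"
    and ab: "a \<otimes> b = b \<otimes> a"
    and c: "c \<otimes> c = z"
    and ac: "(a \<otimes> c) \<otimes> (a \<otimes> c) = z"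
    and cb: "(c \<otimes> b) \<otimes> (c \<otimes> b) = z"
  shows "(a \<otimes> c \<otimes> b) \<otimes> (a \<otimes> c \<otimes> b) = z"
proof -
  have "a \<otimes> c \<otimes> b \<otimes> (a \<otimes> c \<otimes> b) = a \<otimes> c \<otimes> (b \<otimes> a) \<otimes> (c \<otimes> b)"
    using cl by (simp add: m_assoc)
  also have "\<dots> = (a \<otimes> c \<otimes> (a \<otimes> c)) \<otimes> (inv c \<otimes> inv c) \<otimes> (c \<otimes> b \<otimes> (c \<otimes> b))"
  proof -
    have "c \<otimes> (inv c \<otimes> y) = y" "inv c \<otimes> (c \<otimes> y) = y" if "y \<in> carrier G" for y
      using cl(3) that by (simp_all add: m_assoc[symmetric])
    then show ?thesis using cl by (simp add: ab[symmetric] m_assoc)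
  qed
  also have "\<dots> = z"
    unfolding ac cb using cl by (simp add: inv_mult_group[symmetric] c[symmetric] m_assoc[symmetric])
  finally show ?thesis .
qed

lemma (in group) conj_pow:
  assumes "a \<in> carrier G" "b \<in> carrier G"
  shows "(a \<otimes> inv b) [^] (k::nat) \<otimes> a = a \<otimes> (inv b \<otimes> a) [^] k"
proof (induction k)
  case (Suc k)
  have "(a \<otimes> inv b) [^] Suc k \<otimes> a = (a \<otimes> inv b) [^] k \<otimes> a \<otimes> (inv b \<otimes> a)"
    using assms by (simp add: m_assoc)
  also have "\<dots> = a \<otimes> (inv b \<otimes> a) [^] Suc k"
    unfolding Suc using assms by (simp add: m_assoc)
  finally show ?case .
qed (use assms in simp)

text \<open>Two exchanges that each cost the factor \<open>t\<close> cost nothing together.\<close>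

lemma (in group) commute_of_two_swaps:
  assumes cl: "b \<in> carrier G" "c \<in> carrier G" "d \<in> carrier G" "t \<in> carrier G"
    and t: "t \<otimes> t = \<one>" and ct: "t \<otimes> c = c \<otimes> t"
    and bc: "b \<otimes> c = t \<otimes> c \<otimes> b" and bd: "b \<otimes> d = t \<otimes> d \<otimes> b"
  shows "b \<otimes> (c \<otimes> d) = (c \<otimes> d) \<otimes> b"
proof -
  have "b \<otimes> (c \<otimes> d) = t \<otimes> c \<otimes> (b \<otimes> d)"
    using cl bc by (simp add: m_assoc[symmetric])
  also have "\<dots> = c \<otimes> (t \<otimes> t) \<otimes> (d \<otimes> b)"
    unfolding bd ct using cl by (simp add: m_assoc)
  finally show ?thesis using cl t by (simp add: m_assoc)
qed

lemma (in group) commute_inv: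
  assumes "a \<in> carrier G" "b \<in> carrier G" "a \<otimes> b = b \<otimes> a"
  shows "a \<otimes> inv b = inv b \<otimes> a"
proof -
  have "a \<otimes> inv b = inv b \<otimes> (b \<otimes> a) \<otimes> inv b"
    using assms(1,2) by (simp add: m_assoc[symmetric])
  also have "\<dots> = inv b \<otimes> a"
    unfolding assms(3)[symmetric] using assms(1,2) by (simp add: m_assoc)
  finally show ?thesis .
qed

lemma (in group) word_eval_gen:
  assumes "f g \<in> carrier G"
  shows "word_eval G f (gen g) = f g" "word_eval G f (gen_inv g) = inv f g"
  using assms by (simp_all add: gen_def gen_inv_def)

lemma (in group) involution_pow:
  "t \<in> carrier G \<Longrightarrow> t \<otimes> t = \<one> \<Longrightarrow> t [^] (k::nat) = (if even k then \<one> else t)"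
  by (induction k) auto

section \<open>The wreath product with the group of order two\<close>

text \<open>The monomial two by two matrices over \<open>G\<close>: the triple \<open>(a, b, e)\<close> is the diagonal matrix with
  entries \<open>a\<close> and \<open>b\<close>, multiplied on the right by the permutation matrix of the transposition if \<open>e\<close>
  holds.\<close>

definition wreath_two :: "('a, 'b) monoid_scheme \<Rightarrow> ('a \<times> 'a \<times> bool) monoid" where
  "wreath_two G =
    \<lparr>carrier = carrier G \<times> carrier G \<times> UNIV,
     mult = (\<lambda>(a, b, e) (c, d, f).
       if e then (a \<otimes>\<^bsub>G\<^esub> d, b \<otimes>\<^bsub>G\<^esub> c, \<not> f) else (a \<otimes>\<^bsub>G\<^esub> c, b \<otimes>\<^bsub>G\<^esub> d, f)),
     one = (\<one>\<^bsub>G\<^esub>, \<one>\<^bsub>G\<^esub>, False)\<rparr>"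

context group
begin

lemma wreath_two_group: "group (wreath_two G)"
proof (rule groupI)
  fix p assume "p \<in> carrier (wreath_two G)"
  then obtain a b e where p: "p = (a, b, e)" "a \<in> carrier G" "b \<in> carrier G"
    by (auto simp: wreath_two_def)
  show "\<exists>q\<in>carrier (wreath_two G). q \<otimes>\<^bsub>wreath_two G\<^esub> p = \<one>\<^bsub>wreath_two G\<^esub>"
    using p
    by (intro bexI[of _ "if e then (inv b, inv a, True) else (inv a, inv b, False)"])
       (auto simp: wreath_two_def)
qed (auto simp: wreath_two_def m_assoc)

lemma wreath_two_diag_pow:
  "a \<in> carrier G \<Longrightarrow> b \<in> carrier G \<Longrightarrow>
    (a, b, False) [^]\<^bsub>wreath_two G\<^esub> (k::nat) = (a [^] k, b [^] k, False)"
  by (induction k) (simp_all add: wreath_two_def)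

lemma wreath_two_diag_inv:
  assumes "a \<in> carrier G" "b \<in> carrier G"
  shows "inv\<^bsub>wreath_two G\<^esub> (a, b, False) = (inv a, inv b, False)"
proof -
  interpret W: group "wreath_two G" by (rule wreath_two_group)
  show ?thesis
    by (rule W.inv_equality) (use assms in \<open>auto simp: wreath_two_def\<close>)
qed

end

section \<open>The connected extension of the Coxeter graph\<close>

lemma successively_iff_zip_tl:
  "successively P vs \<longleftrightarrow> (\<forall>(x, y) \<in> set (zip vs (tl vs)). P x y)"
  by (induction vs rule: induct_list012) auto

lemma zip_rotate1: "zip vs (rotate1 vs) = zip (vs @ [hd vs]) (tl (vs @ [hd vs]))"
  using zip_append1[of vs "[hd vs]" "rotate1 vs"] by (cases vs) simp_all

locale extended_coxeter_graph =
  fixes n :: nat and m :: "nat \<Rightarrow> nat \<Rightarrow> enat" and E :: "nat set set"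
  assumes matrix: "coxeter_matrix n m"
    and extension: "connected_extension n m E"
begin

abbreviation adj :: "nat \<Rightarrow> nat \<Rightarrow> bool" where
  "adj i j \<equiv> {i, j} \<in> E"

lemma adj_sym: "adj i j \<Longrightarrow> adj j i"
  by (simp add: insert_commute)

lemma adj_bounds:
  assumes "adj i j"
  shows "i < n" "j < n" "i \<noteq> j"
  by (rule connected_extension_edge[OF extension assms]; auto simp: doubleton_eq_iff)+

lemma adj_irrefl: "\<not> adj i i"
  using adj_bounds(3) by blast

lemma exponent_diag: "i < n \<Longrightarrow> m i i = 1"
  using matrix by (simp add: coxeter_matrix_def)

lemma exponent_non_edge:
  assumes "i < n" "j < n" "i \<noteq> j" "\<not> adj i j"
  shows "m i j = 2"
proof -
  have "\<not> 3 \<le> m i j"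
    using assms extension unfolding connected_extension_def coxeter_edges_def by blast
  moreover have "2 \<le> m i j"
    using matrix assms by (simp add: coxeter_matrix_def)
  ultimately show ?thesis
    by (cases "m i j") (auto simp: numeral_eq_enat)
qed

lemma exponent_pos:
  assumes "i < n" "j < n" "m i j = enat k"
  shows "1 \<le> k"
proof (cases "i = j")
  case True
  then show ?thesis using assms exponent_diag[of i] by (simp add: one_enat_def)
next
  case False
  then have "2 \<le> m i j" using matrix assms(1,2) unfolding coxeter_matrix_def by blast
  then show ?thesis using assms(3) by (simp add: numeral_eq_enat)
qed

lemma connected:
  assumes "i < n" "j < n"
  shows "adj\<^sup>*\<^sup>* i j"
proof -
  define c where "c = (\<lambda>k l. {k, l} \<in> coxeter_edges n m)"
  obtain Cs vs where Cs: "set Cs = coxeter_components n m" "length vs = length Cs"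
      "\<And>a. a < length Cs \<Longrightarrow> vs ! a \<in> Cs ! a"
    and E: "E = coxeter_edges n m \<union> {{vs ! l, vs ! Suc l} | l. Suc l < length vs}"
    using extension unfolding connected_extension_def by auto
  have "c \<le> adj" by (auto simp: c_def E)
  then have c_adj: "c\<^sup>*\<^sup>* k l \<Longrightarrow> adj\<^sup>*\<^sup>* k l" for k l
    using rtranclp_mono by blast
  have sym: "adj\<^sup>*\<^sup>* l k" if "adj\<^sup>*\<^sup>* k l" for k l
    using that by (induction rule: rtranclp_induct) (blast intro: adj_sym converse_rtranclp_into_rtranclp)+
  have chain: "a < length vs \<Longrightarrow> adj\<^sup>*\<^sup>* (vs ! 0) (vs ! a)" for a
  proof (induction a)
    case (Suc a)
    have "adj (vs ! a) (vs ! Suc a)" using Suc.prems E by blast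
    then show ?case using Suc by (meson Suc_lessD rtranclp.rtrancl_into_rtrancl)
  qed simp
  \<comment> \<open>Every vertex reaches the chosen vertex of its component, and the virtual edges chain those.\<close>
  have hub: "adj\<^sup>*\<^sup>* k (vs ! 0)" if "k < n" for k
  proof -
    let ?R = "{(i, j). i < n \<and> j < n \<and> (i, j) \<in> {(k, l). {k, l} \<in> coxeter_edges n m}\<^sup>*}"
    have "?R `` {k} \<in> set Cs"
      using that Cs(1) unfolding coxeter_components_def quotient_def by auto
    then obtain a where a: "a < length Cs" "Cs ! a = ?R `` {k}"
      by (auto simp: in_set_conv_nth)
    then have "c\<^sup>*\<^sup>* k (vs ! a)"
      using Cs(3)[OF a(1)] by (simp add: rtranclp_rtrancl_eq c_def)
    then have "adj\<^sup>*\<^sup>* k (vs ! a)" by (rule c_adj)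
    also have "adj\<^sup>*\<^sup>* (vs ! a) (vs ! 0)" using chain a Cs(2) sym by simp
    finally show ?thesis .
  qed
  show ?thesis using hub[OF assms(1)] sym[OF hub[OF assms(2)]] by (rule rtranclp_trans)
qed


section \<open>The group presented by the edges\<close>

abbreviation Q :: "edge_generator word set monoid" where
  "Q \<equiv> edge_group m E"

abbreviation edge_class :: "edge_generator word \<Rightarrow> edge_generator word set" where
  "edge_class \<equiv> word_class (edge_gens E) (edge_rels m E)"

abbreviation r :: "nat \<Rightarrow> nat \<Rightarrow> edge_generator word set" where
  "r i j \<equiv> edge_class (edge_word i j)"

abbreviation z :: "edge_generator word set" where
  "z \<equiv> edge_class (gen ZGen)"

sublocale Q: group Q
  unfolding edge_group_def by (rule presented_group_group)

lemma edge_word_in [simp]: "adj i j \<Longrightarrow> edge_word i j \<in> words (edge_gens E)"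
  by (rule edge_word_words[OF extension])

lemma z_word_in [simp]: "gen ZGen \<in> words (edge_gens E)"
  by (simp add: gen_def edge_gens_def)

lemma edge_class_closed [simp]: "w \<in> words (edge_gens E) \<Longrightarrow> edge_class w \<in> carrier Q"
  unfolding edge_group_def by (rule word_class_closed)

lemma edge_group_cases:
  assumes "q \<in> carrier Q"
  obtains w where "w \<in> words (edge_gens E)" "q = edge_class w"
  using assms by (auto simp: edge_group_def presented_group_def)

lemma edge_class_append:
  "u \<in> words (edge_gens E) \<Longrightarrow> v \<in> words (edge_gens E) \<Longrightarrow>
    edge_class (u @ v) = edge_class u \<otimes>\<^bsub>Q\<^esub> edge_class v"
  unfolding edge_group_def by (simp add: presented_mult)

lemma edge_class_Nil: "edge_class [] = \<one>\<^bsub>Q\<^esub>"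
  by (simp add: edge_group_def presented_group_def)

lemma edge_class_pow:
  "w \<in> words (edge_gens E) \<Longrightarrow> edge_class (word_pow w k) = edge_class w [^]\<^bsub>Q\<^esub> k"
  unfolding edge_group_def by (simp add: presented_pow)

lemma edge_class_rel: "(u, v) \<in> edge_rels m E \<Longrightarrow> edge_class u = edge_class v"
  using edge_rels_words[OF extension] by (intro word_class_eq pres_eq_rel) auto

lemma edge_rels_intros:
  "i < j \<Longrightarrow> adj i j \<Longrightarrow> m i j = enat k \<Longrightarrow>
    (word_pow (edge_word i j) k, word_pow (gen ZGen) (k - 1)) \<in> edge_rels m E"
  "graph_cycle E vs \<Longrightarrow> (concat (map2 edge_word vs (rotate1 vs)), []) \<in> edge_rels m E"
  "adj i j \<Longrightarrow> adj j k \<Longrightarrow> i < k \<Longrightarrow> m i k = 2 \<Longrightarrow>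
    (word_pow (edge_word i j @ edge_word j k) 2, gen ZGen) \<in> edge_rels m E"
  "adj i j \<Longrightarrow> adj j k \<Longrightarrow> adj k l \<Longrightarrow> i < l \<Longrightarrow> m i l = 2 \<Longrightarrow>
    (word_pow (edge_word i j @ edge_word j k @ edge_word k l) 2, gen ZGen) \<in> edge_rels m E"
  "adj i j \<Longrightarrow> adj k l \<Longrightarrow> not_connected E {i, j} {k, l} \<Longrightarrow>
    (edge_word i j @ edge_word k l, edge_word k l @ edge_word i j) \<in> edge_rels m E"
  "i < j \<Longrightarrow> adj i j \<Longrightarrow>
    (gen ZGen @ edge_word i j, edge_word i j @ gen ZGen) \<in> edge_rels m E"
  "(word_pow (gen ZGen) 2, []) \<in> edge_rels m E"
  unfolding edge_rels_def by blast+

lemma edge_class_inv_gen: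
  assumes "g \<in> edge_gens E"
  shows "edge_class [(g, \<not> b)] = inv\<^bsub>Q\<^esub> edge_class [(g, b)]"
proof -
  have "edge_class [(g, \<not> b)] \<otimes>\<^bsub>Q\<^esub> edge_class [(g, b)] = edge_class [(g, \<not> b), (g, b)]"
    using edge_class_append[of "[(g, \<not> b)]" "[(g, b)]"] assms by simp
  also have "\<dots> = \<one>\<^bsub>Q\<^esub>"
    unfolding edge_class_Nil[symmetric]
    using pres_eq_cancel[OF assms, where R = "edge_rels m E" and b = "\<not> b"] by (intro word_class_eq) simp
  finally show ?thesis using assms by (intro Q.inv_equality[symmetric]) auto
qed

lemma r_rev: "adj i j \<Longrightarrow> r j i = inv\<^bsub>Q\<^esub> r i j"
  using adj_bounds(3)[of i j] adj_sym[of i j]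
    edge_class_inv_gen[of "RTilde i j" True] edge_class_inv_gen[of "RTilde j i" False]
  by (auto simp: edge_word_def gen_def gen_inv_def edge_gens_def neq_iff)

lemma z_square: "z \<otimes>\<^bsub>Q\<^esub> z = \<one>\<^bsub>Q\<^esub>"
proof -
  have "z [^]\<^bsub>Q\<^esub> (2::nat) = \<one>\<^bsub>Q\<^esub>"
    unfolding edge_class_Nil[symmetric] edge_class_pow[OF z_word_in, symmetric]
    by (intro edge_class_rel edge_rels_intros)
  then show ?thesis by (simp add: numeral_2_eq_2)
qed

lemma inv_z: "inv\<^bsub>Q\<^esub> z = z"
  using z_square by (intro Q.inv_equality) auto

lemma z_comm_r:
  assumes "adj i j"
  shows "z \<otimes>\<^bsub>Q\<^esub> r i j = r i j \<otimes>\<^bsub>Q\<^esub> z"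
proof -
  have lt: "z \<otimes>\<^bsub>Q\<^esub> r i j = r i j \<otimes>\<^bsub>Q\<^esub> z" if "adj i j" "i < j" for i j
    using edge_class_rel[OF edge_rels_intros(6)[OF that(2,1)]] that
    by (simp add: edge_class_append)
  show ?thesis
  proof (cases "i < j")
    case False
    have "z \<otimes>\<^bsub>Q\<^esub> r j i = r j i \<otimes>\<^bsub>Q\<^esub> z"
      using False assms adj_bounds(3)[OF assms] adj_sym by (intro lt) auto
    then show ?thesis
      using Q.commute_inv[of z "r j i"] assms adj_sym[OF assms] r_rev[of j i] by simp
  qed (use assms lt in blast)
qed

lemma z_central:
  assumes "q \<in> carrier Q"
  shows "z \<otimes>\<^bsub>Q\<^esub> q = q \<otimes>\<^bsub>Q\<^esub> z"
proof -
  have "z \<otimes>\<^bsub>Q\<^esub> edge_class w = edge_class w \<otimes>\<^bsub>Q\<^esub> z" if "w \<in> words (edge_gens E)" for w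
    using that
  proof (induction w)
    case (Cons a w)
    obtain g b where a: "a = (g, b)" by force
    have g: "g \<in> edge_gens E" and w: "w \<in> words (edge_gens E)" using Cons.prems a by auto
    have pos: "z \<otimes>\<^bsub>Q\<^esub> edge_class [(g, True)] = edge_class [(g, True)] \<otimes>\<^bsub>Q\<^esub> z"
    proof (cases g)
      case (RTilde i j)
      then show ?thesis using g z_comm_r[of i j] by (auto simp: edge_gens_def edge_word_def gen_def)
    qed (simp add: gen_def)
    have "z \<otimes>\<^bsub>Q\<^esub> edge_class [(g, b)] = edge_class [(g, b)] \<otimes>\<^bsub>Q\<^esub> z"
    proof (cases b)
      case False
      then show ?thesis
        using Q.commute_inv[OF _ _ pos] edge_class_inv_gen[OF g, of True] g by simp
    qed (use pos in simp)
    moreover have "edge_class (a # w) = edge_class [(g, b)] \<otimes>\<^bsub>Q\<^esub> edge_class w"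
      using edge_class_append[of "[(g, b)]" w] g w a by simp
    ultimately show ?case
      using Cons.IH[OF w] g w by (simp add: Q.m_assoc[symmetric]) (simp add: Q.m_assoc)
  qed (simp add: edge_class_Nil)
  then show ?thesis using edge_group_cases[OF assms] by metis
qed

text \<open>The power relations are given for \<open>i < j\<close> only. The reversed edges satisfy them as well, because
  \<open>z\<close> is its own inverse.\<close>

lemma edge_power:
  assumes "adj i j" "m i j = enat k"
  shows "r i j [^]\<^bsub>Q\<^esub> k = z [^]\<^bsub>Q\<^esub> (k - 1)"
proof -
  have lt: "r i j [^]\<^bsub>Q\<^esub> k = z [^]\<^bsub>Q\<^esub> (k - 1)" if "adj i j" "m i j = enat k" "i < j" for i j
    using edge_class_rel[OF edge_rels_intros(1)[OF that(3,1,2)]] that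
    by (simp add: edge_class_pow)
  show ?thesis
  proof (cases "i < j")
    case False
    have "m j i = enat k"
      using matrix adj_bounds[OF assms(1)] assms(2) unfolding coxeter_matrix_def by metis
    then have "r j i [^]\<^bsub>Q\<^esub> k = z [^]\<^bsub>Q\<^esub> (k - 1)"
      using False assms adj_bounds(3)[OF assms(1)] adj_sym by (intro lt) auto
    then show ?thesis
      using adj_sym[OF assms(1)] r_rev[of j i] by (simp add: Q.nat_pow_inv[symmetric] Q.nat_pow_inv inv_z)
  qed (use assms lt in blast)
qed

lemma edge_class_walk:
  "successively adj vs \<Longrightarrow>
    concat (map2 edge_word vs (tl vs)) \<in> words (edge_gens E) \<and>
    edge_class (concat (map2 edge_word vs (tl vs))) = Q.walk_prod r vs"
  by (induction vs rule: induct_list012) (simp_all add: edge_class_Nil edge_class_append)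

sublocale r: cycle_trivial_labelling Q adj r
proof
  fix vs :: "nat list"
  assume vs: "distinct vs" "3 \<le> length vs" "successively adj (vs @ [hd vs])"
  then have "graph_cycle E vs"
    by (simp add: graph_cycle_def zip_rotate1 successively_iff_zip_tl)
  then have "edge_class (concat (map2 edge_word vs (rotate1 vs))) = \<one>\<^bsub>Q\<^esub>"
    unfolding edge_class_Nil[symmetric] by (intro edge_class_rel edge_rels_intros)
  then show "Q.walk_prod r (vs @ [hd vs]) = \<one>\<^bsub>Q\<^esub>"
    using edge_class_walk[OF vs(3)] by (simp add: zip_rotate1)
qed (rule adj_sym adj_irrefl r_rev edge_class_closed[OF edge_word_in]; assumption)+


section \<open>Powers of quotients of the potential\<close>

definition is_potential :: "(nat \<Rightarrow> edge_generator word set) \<Rightarrow> bool" where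
  "is_potential p \<longleftrightarrow> (\<forall>i<n. p i \<in> carrier Q) \<and>
    (\<forall>i j. adj i j \<longrightarrow> r i j = inv\<^bsub>Q\<^esub> p i \<otimes>\<^bsub>Q\<^esub> p j)"

definition pot :: "nat \<Rightarrow> edge_generator word set" where
  "pot = (SOME p. is_potential p)"

lemma pot_closed [simp]: "i < n \<Longrightarrow> pot i \<in> carrier Q"
  and r_pot: "adj i j \<Longrightarrow> r i j = inv\<^bsub>Q\<^esub> pot i \<otimes>\<^bsub>Q\<^esub> pot j"
proof -
  obtain p where p: "\<And>v. adj\<^sup>*\<^sup>* 0 v \<Longrightarrow> p v \<in> carrier Q"
    "\<And>v w. adj\<^sup>*\<^sup>* 0 v \<Longrightarrow> adj v w \<Longrightarrow> r v w = inv\<^bsub>Q\<^esub> p v \<otimes>\<^bsub>Q\<^esub> p w"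
    using r.potential_exists[of 0] by blast
  \<comment> \<open>The base point \<open>0\<close> is a vertex unless there are no vertices at all.\<close>
  have "adj\<^sup>*\<^sup>* 0 v" if "v < n" for v
    using that by (intro connected) auto
  then have "is_potential p"
    using p adj_bounds unfolding is_potential_def by blast
  then have "is_potential pot"
    unfolding pot_def by (rule someI[of is_potential])
  then show "i < n \<Longrightarrow> pot i \<in> carrier Q"
    and "adj i j \<Longrightarrow> r i j = inv\<^bsub>Q\<^esub> pot i \<otimes>\<^bsub>Q\<^esub> pot j"
    unfolding is_potential_def by blast+
qed

text \<open>The element of \<open>Q\<close> that corresponds to \<open>s\<^sub>i s\<^sub>j\<close>, for vertices \<open>i\<close> and \<open>j\<close> that need not be adjacent.\<close>

abbreviation \<rho> :: "nat \<Rightarrow> nat \<Rightarrow> edge_generator word set" where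
  "\<rho> i j \<equiv> inv\<^bsub>Q\<^esub> pot i \<otimes>\<^bsub>Q\<^esub> pot j"

lemma \<rho>_mult: "i < n \<Longrightarrow> j < n \<Longrightarrow> k < n \<Longrightarrow> \<rho> i j \<otimes>\<^bsub>Q\<^esub> \<rho> j k = \<rho> i k"
  by (simp add: Q.m_assoc) (simp add: Q.m_assoc[symmetric])

lemma \<rho>_inv: "i < n \<Longrightarrow> j < n \<Longrightarrow> inv\<^bsub>Q\<^esub> \<rho> i j = \<rho> j i"
  by (simp add: Q.inv_mult_group)

definition squares_to_z :: "nat \<Rightarrow> nat \<Rightarrow> bool" where
  "squares_to_z i j \<longleftrightarrow> \<rho> i j \<otimes>\<^bsub>Q\<^esub> \<rho> i j = z"

lemma squares_to_z_sym:
  assumes "i < n" "j < n" "squares_to_z i j"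
  shows "squares_to_z j i"
proof -
  have "inv\<^bsub>Q\<^esub> (\<rho> i j \<otimes>\<^bsub>Q\<^esub> \<rho> i j) = inv\<^bsub>Q\<^esub> \<rho> i j \<otimes>\<^bsub>Q\<^esub> inv\<^bsub>Q\<^esub> \<rho> i j"
    using assms(1,2) by (intro Q.inv_mult_group) auto
  also have "\<dots> = \<rho> j i \<otimes>\<^bsub>Q\<^esub> \<rho> j i"
    using assms(1,2) by (simp only: \<rho>_inv)
  finally show ?thesis using assms(3) by (simp only: squares_to_z_def inv_z)
qed

lemma squares_to_z_two:
  assumes "adj i j" "adj j k" "i \<noteq> k" "m i k = 2"
  shows "squares_to_z i k"
proof -
  note b = adj_bounds[OF assms(1)] adj_bounds[OF assms(2)]
  have lt: "squares_to_z i k" if "adj i j" "adj j k" "i < k" "m i k = 2" for i k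
  proof -
    have "(r i j \<otimes>\<^bsub>Q\<^esub> r j k) [^]\<^bsub>Q\<^esub> (2::nat) = z"
      using edge_class_rel[OF edge_rels_intros(3)[OF that]] that(1,2)
      by (simp add: edge_class_pow edge_class_append)
    moreover have "r i j \<otimes>\<^bsub>Q\<^esub> r j k = \<rho> i k"
      using that(1,2) adj_bounds[OF that(1)] adj_bounds[OF that(2)] by (simp add: r_pot \<rho>_mult)
    ultimately show ?thesis
      using adj_bounds[OF that(1)] adj_bounds[OF that(2)]
      by (simp add: squares_to_z_def numeral_2_eq_2)
  qed
  show ?thesis
  proof (cases "i < k")
    case False
    have "m k i = 2" using matrix b assms(4) unfolding coxeter_matrix_def by metis
    then have "squares_to_z k i" using False assms(3) adj_sym[OF assms(1)] adj_sym[OF assms(2)]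
      by (intro lt) auto
    with b show ?thesis by (blast intro: squares_to_z_sym[of k i])
  qed (use assms lt in blast)
qed

lemma squares_to_z_three:
  assumes "adj i j" "adj j k" "adj k l" "i \<noteq> l" "m i l = 2"
  shows "squares_to_z i l"
proof -
  note b = adj_bounds[OF assms(1)] adj_bounds[OF assms(3)]
  have lt: "squares_to_z i l" if "adj i j" "adj j k" "adj k l" "i < l" "m i l = 2" for i j k l
  proof -
    note b' = adj_bounds[OF that(1)] adj_bounds[OF that(2)] adj_bounds[OF that(3)]
    have "(r i j \<otimes>\<^bsub>Q\<^esub> (r j k \<otimes>\<^bsub>Q\<^esub> r k l)) [^]\<^bsub>Q\<^esub> (2::nat) = z"
      using edge_class_rel[OF edge_rels_intros(4)[OF that]] that(1,2,3)
      by (simp add: edge_class_pow edge_class_append)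
    moreover have "r i j \<otimes>\<^bsub>Q\<^esub> (r j k \<otimes>\<^bsub>Q\<^esub> r k l) = \<rho> i l"
      using that(1,2,3) b' by (simp add: r_pot \<rho>_mult)
    ultimately show ?thesis
      using b' by (simp add: squares_to_z_def numeral_2_eq_2)
  qed
  show ?thesis
  proof (cases "i < l")
    case False
    have "m l i = 2" using matrix b assms(5) unfolding coxeter_matrix_def by metis
    then have "squares_to_z l i"
      using False assms(4) adj_sym[OF assms(1)] adj_sym[OF assms(2)] adj_sym[OF assms(3)]
      by (intro lt) auto
    with b show ?thesis by (blast intro: squares_to_z_sym[of l i])
  qed (use assms lt in blast)
qed

text \<open>Induction on the length of the segments of a fixed geodesic \<open>f\<close> from \<open>i\<close> to \<open>j\<close>. Segments of a
  geodesic are geodesics, so the vertices of \<open>f\<close> at distance at least two are distinct and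
  non-adjacent. Lengths two and three are defining relations. In a segment of length at least four
  the first and the last edge are not connected, hence commute, and lemma
  \<open>square_of_triple_product\<close> reduces the claim to three shorter segments.\<close>

lemma squares_to_z_non_edge:
  assumes "i < n" "j < n" "i \<noteq> j" "\<not> adj i j"
  shows "squares_to_z i j"
proof -
  define d where "d = (LEAST d. (adj ^^ d) i j)"
  have "\<exists>d. (adj ^^ d) i j" using connected[OF assms(1,2)] by (rule rtranclp_imp_relpowp)
  then have "(adj ^^ d) i j" unfolding d_def by (rule LeastI_ex)
  then obtain f where f: "f 0 = i" "f d = j" "\<And>a. a < d \<Longrightarrow> adj (f a) (f (Suc a))"
    by (auto simp: relpowp_fun_conv)
  have piece: "(adj ^^ (b - a)) (f a) (f b)" if "a \<le> b" "b \<le> d" for a b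
    unfolding relpowp_fun_conv using that f(3) by (intro exI[of _ "\<lambda>c. f (a + c)"]) auto
  have geodesic: "b - a \<le> k" if "a \<le> b" "b \<le> d" "(adj ^^ k) (f a) (f b)" for a b k
  proof -
    have "(adj ^^ a) i (f a)" "(adj ^^ (d - b)) (f b) j"
      using piece[of 0 a] piece[of b d] that(1,2) f(1,2) by auto
    then have "(adj ^^ (a + k + (d - b))) i j"
      using that(3) unfolding relpowp_add by blast
    then have "d \<le> a + k + (d - b)" unfolding d_def by (rule Least_le)
    then show ?thesis using that by simp
  qed
  have bound: "f a < n" if "a \<le> d" for a
    using that adj_bounds(1)[OF f(3)[of a]] f(2) assms(2) by (cases "a = d") auto
  have dist: "f a \<noteq> f b" "\<not> adj (f a) (f b)" if "a + 2 \<le> b" "b \<le> d" for a b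
    using geodesic[of a b 0] geodesic[of a b 1] that by (auto simp: eq_OO)
  have two: "m (f a) (f b) = 2" if "a + 2 \<le> b" "b \<le> d" for a b
    using that dist bound by (intro exponent_non_edge) auto
  have "squares_to_z (f a) (f b)" if "a + 2 \<le> b" "b \<le> d" for a b
    using that
  proof (induction "b - a" arbitrary: a b rule: less_induct)
    case less
    consider "b = a + 2" | "b = a + 3" | "a + 4 \<le> b" using less.prems by linarith
    then show ?case
    proof cases
      case 1
      then show ?thesis
        using less.prems f(3)[of a] f(3)[of "a + 1"] dist[of a b] two[of a b]
        by (intro squares_to_z_two[of _ "f (a + 1)"]) auto
    next
      case 2
      then show ?thesis
        using less.prems f(3)[of a] f(3)[of "a + 1"] f(3)[of "a + 2"] dist[of a b] two[of a b]
        by (intro squares_to_z_three[of _ "f (a + 1)" "f (a + 2)"]) (auto simp: numeral_3_eq_3)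
    next
      case 3
      define c where "c = b - 1"
      have c: "b = Suc c" "a + 3 \<le> c" using 3 by (auto simp: c_def)
      have e: "adj (f a) (f (Suc a))" "adj (f c) (f b)"
        using f(3)[of a] f(3)[of c] less.prems c by auto
      have lt: "f a < n" "f b < n" "f c < n" "f (Suc a) < n" using e adj_bounds by blast+
      have "not_connected E {f a, f (Suc a)} {f c, f b}"
        using dist[of a c] dist[of a b] dist[of "Suc a" c] dist[of "Suc a" b] c less.prems(2)
        by (auto simp: not_connected_def)
      then have comm: "\<rho> (f a) (f (Suc a)) \<otimes>\<^bsub>Q\<^esub> \<rho> (f c) (f b)
          = \<rho> (f c) (f b) \<otimes>\<^bsub>Q\<^esub> \<rho> (f a) (f (Suc a))"
        using edge_class_rel[OF edge_rels_intros(5)[OF e]] e by (simp add: edge_class_append r_pot)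
      have mid: "squares_to_z (f (Suc a)) (f c)" "squares_to_z (f a) (f c)"
        "squares_to_z (f (Suc a)) (f b)"
        using less.prems c by (auto intro!: less.hyps)
      have "\<rho> (f a) (f (Suc a)) \<otimes>\<^bsub>Q\<^esub> \<rho> (f (Suc a)) (f c) \<otimes>\<^bsub>Q\<^esub> \<rho> (f c) (f b) = \<rho> (f a) (f b)"
        using lt by (simp only: \<rho>_mult)
      then show ?thesis
        using Q.square_of_triple_product[OF _ _ _ comm, of "\<rho> (f (Suc a)) (f c)" z] lt mid
        by (simp only: squares_to_z_def \<rho>_mult pot_closed Q.m_closed Q.inv_closed)
    qed
  qed
  moreover have "2 \<le> d"
  proof -
    have "d \<noteq> 0" using f(1,2) assms(3) by metis
    moreover have "d \<noteq> 1" using f(1,2) f(3)[of 0] assms(4) by (metis One_nat_def zero_less_one)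
    ultimately show ?thesis by simp
  qed
  ultimately show ?thesis using f(1,2) by (metis add_0 order_refl)
qed

lemma \<rho>_power:
  assumes "i < n" "j < n" "m i j = enat k"
  shows "\<rho> i j [^]\<^bsub>Q\<^esub> k = z [^]\<^bsub>Q\<^esub> (k - 1)"
proof -
  consider "i = j" | "adj i j" | "i \<noteq> j" "\<not> adj i j" by blast
  then show ?thesis
  proof cases
    case 1
    then show ?thesis using assms exponent_diag[of i] by (simp add: one_enat_def)
  next
    case 2
    then show ?thesis using edge_power[OF _ assms(3)] by (simp add: r_pot)
  next
    case 3
    then have "k = 2" using exponent_non_edge[OF assms(1,2)] assms(3) by (simp add: numeral_eq_enat)
    then show ?thesis
      using squares_to_z_non_edge[OF assms(1,2) 3] assms(1,2)
      by (simp add: squares_to_z_def numeral_2_eq_2)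
  qed
qed

text \<open>The other diagonal entry of \<open>\<Psi> (s\<^sub>i s\<^sub>j)\<close>; it is a conjugate of \<open>\<rho>\<^sub>j\<^sub>i\<close>.\<close>

lemma \<rho>_power_conj:
  assumes "i < n" "j < n" "m i j = enat k"
  shows "(pot i \<otimes>\<^bsub>Q\<^esub> inv\<^bsub>Q\<^esub> pot j) [^]\<^bsub>Q\<^esub> k = z [^]\<^bsub>Q\<^esub> (k - 1)"
proof -
  have "m j i = enat k" using matrix assms unfolding coxeter_matrix_def by metis
  then have "(pot i \<otimes>\<^bsub>Q\<^esub> inv\<^bsub>Q\<^esub> pot j) [^]\<^bsub>Q\<^esub> k \<otimes>\<^bsub>Q\<^esub> pot i = pot i \<otimes>\<^bsub>Q\<^esub> z [^]\<^bsub>Q\<^esub> (k - 1)"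
    using assms(1,2) Q.conj_pow[of "pot i" "pot j" k] \<rho>_power[of j i k] by simp
  also have "\<dots> = z [^]\<^bsub>Q\<^esub> (k - 1) \<otimes>\<^bsub>Q\<^esub> pot i"
    using assms(1) Q.group_commutes_pow[of z "pot i" "k - 1"] z_central[of "pot i"] by simp
  finally show ?thesis
    using assms(1,2) by (simp add: Q.right_cancel)
qed


section \<open>The homomorphism from the edge group\<close>

abbreviation P :: "cover_generator word set monoid" where
  "P \<equiv> cover_group n m"

abbreviation cover_class :: "cover_generator word \<Rightarrow> cover_generator word set" where
  "cover_class \<equiv> word_class (cover_gens n) (cover_rels n m)"

abbreviation s :: "nat \<Rightarrow> cover_generator word set" where
  "s i \<equiv> cover_class (gen (STilde i))"

abbreviation \<alpha> :: "cover_generator word set" where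
  "\<alpha> \<equiv> cover_class (gen Alpha)"

sublocale P: group P
  by (rule cover_group_group)

lemma s_word_in [simp]: "i < n \<Longrightarrow> gen (STilde i) \<in> words (cover_gens n)"
  and \<alpha>_word_in [simp]: "gen Alpha \<in> words (cover_gens n)"
  by (simp_all add: gen_def cover_gens_def)

lemma cover_class_closed [simp]: "w \<in> words (cover_gens n) \<Longrightarrow> cover_class w \<in> carrier P"
  unfolding cover_group_def by (rule word_class_closed)

lemma cover_class_append:
  "u \<in> words (cover_gens n) \<Longrightarrow> v \<in> words (cover_gens n) \<Longrightarrow>
    cover_class (u @ v) = cover_class u \<otimes>\<^bsub>P\<^esub> cover_class v"
  unfolding cover_group_def by (simp add: presented_mult)

lemma cover_class_Nil: "cover_class [] = \<one>\<^bsub>P\<^esub>"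
  by (simp add: cover_group_def presented_group_def)

lemma cover_class_pow:
  "w \<in> words (cover_gens n) \<Longrightarrow> cover_class (word_pow w k) = cover_class w [^]\<^bsub>P\<^esub> k"
  unfolding cover_group_def by (simp add: presented_pow)

lemma cover_class_rel: "(u, v) \<in> cover_rels n m \<Longrightarrow> cover_class u = cover_class v"
  using cover_rels_words by (intro word_class_eq pres_eq_rel) auto

lemma cover_rels_intros:
  "i < n \<Longrightarrow> j < n \<Longrightarrow> m i j = enat k \<Longrightarrow> odd k \<Longrightarrow>
    (word_pow (gen (STilde i) @ gen (STilde j)) k, []) \<in> cover_rels n m"
  "i < n \<Longrightarrow> j < n \<Longrightarrow> m i j = enat k \<Longrightarrow> even k \<Longrightarrow>
    (word_pow (gen (STilde i) @ gen (STilde j)) k, gen Alpha) \<in> cover_rels n m"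
  "i < n \<Longrightarrow> (gen Alpha @ gen (STilde i), gen (STilde i) @ gen Alpha) \<in> cover_rels n m"
  "(word_pow (gen Alpha) 2, []) \<in> cover_rels n m"
  unfolding cover_rels_def by blast+

lemma \<alpha>_square: "\<alpha> \<otimes>\<^bsub>P\<^esub> \<alpha> = \<one>\<^bsub>P\<^esub>"
proof -
  have "\<alpha> [^]\<^bsub>P\<^esub> (2::nat) = \<one>\<^bsub>P\<^esub>"
    unfolding cover_class_Nil[symmetric] cover_class_pow[OF \<alpha>_word_in, symmetric]
    by (intro cover_class_rel cover_rels_intros)
  then show ?thesis by (simp add: numeral_2_eq_2)
qed

lemma \<alpha>_comm: "i < n \<Longrightarrow> \<alpha> \<otimes>\<^bsub>P\<^esub> s i = s i \<otimes>\<^bsub>P\<^esub> \<alpha>"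
  using cover_class_rel[OF cover_rels_intros(3)] by (simp add: cover_class_append)

text \<open>The odd and the even relations of \<open>P\<close> in one form, which is the form of the power relations of \<open>Q\<close>.\<close>

lemma s_power:
  assumes "i < n" "j < n" "m i j = enat k"
  shows "(s i \<otimes>\<^bsub>P\<^esub> s j) [^]\<^bsub>P\<^esub> k = \<alpha> [^]\<^bsub>P\<^esub> (k - 1)"
proof -
  have "1 \<le> k" using exponent_pos assms by blast
  then have a: "\<alpha> [^]\<^bsub>P\<^esub> (k - 1) = (if even k then \<alpha> else \<one>\<^bsub>P\<^esub>)"
    using P.involution_pow[OF _ \<alpha>_square] by simp
  have "(s i \<otimes>\<^bsub>P\<^esub> s j) [^]\<^bsub>P\<^esub> k = cover_class (word_pow (gen (STilde i) @ gen (STilde j)) k)"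
    using assms(1,2) by (simp add: cover_class_pow cover_class_append)
  also have "\<dots> = (if even k then \<alpha> else cover_class [])"
    using cover_class_rel[OF cover_rels_intros(1)[OF assms]]
      cover_class_rel[OF cover_rels_intros(2)[OF assms]] by simp
  finally show ?thesis unfolding a cover_class_Nil .
qed

lemma s_square: "i < n \<Longrightarrow> s i \<otimes>\<^bsub>P\<^esub> s i = \<one>\<^bsub>P\<^esub>"
  using s_power[of i i 1] exponent_diag[of i] by (simp add: one_enat_def)

lemma s_inv: "i < n \<Longrightarrow> inv\<^bsub>P\<^esub> s i = s i"
  using s_square by (intro P.inv_equality) auto

lemma s_cancel:
  assumes "i < n" "j < n" "q \<in> carrier P"
  shows "(s i \<otimes>\<^bsub>P\<^esub> s j) \<otimes>\<^bsub>P\<^esub> (s j \<otimes>\<^bsub>P\<^esub> q) = s i \<otimes>\<^bsub>P\<^esub> q"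
proof -
  have "(s i \<otimes>\<^bsub>P\<^esub> s j) \<otimes>\<^bsub>P\<^esub> (s j \<otimes>\<^bsub>P\<^esub> q) = s i \<otimes>\<^bsub>P\<^esub> ((s j \<otimes>\<^bsub>P\<^esub> s j) \<otimes>\<^bsub>P\<^esub> q)"
    using assms by (simp add: P.m_assoc)
  then show ?thesis using assms by (simp add: s_square)
qed

lemma s_swap:
  assumes "i < n" "j < n" "i \<noteq> j" "\<not> adj i j"
  shows "s i \<otimes>\<^bsub>P\<^esub> s j = \<alpha> \<otimes>\<^bsub>P\<^esub> s j \<otimes>\<^bsub>P\<^esub> s i"
proof -
  let ?p = "s i \<otimes>\<^bsub>P\<^esub> s j"
  have "m i j = enat 2" using exponent_non_edge[OF assms] by (simp add: numeral_eq_enat)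
  then have "?p [^]\<^bsub>P\<^esub> (2::nat) = \<alpha>"
    using s_power[OF assms(1,2), of 2] by simp
  then have "?p \<otimes>\<^bsub>P\<^esub> ?p = \<alpha>" using assms by (simp add: numeral_2_eq_2)
  then have "\<alpha> \<otimes>\<^bsub>P\<^esub> inv\<^bsub>P\<^esub> ?p = ?p"
    using assms by (metis P.inv_solve_right' P.m_closed cover_class_closed s_word_in)
  then show ?thesis using assms by (simp add: P.inv_mult_group s_inv P.m_assoc)
qed

fun edge_to_cover :: "edge_generator \<Rightarrow> cover_generator word set" where
  "edge_to_cover (RTilde i j) = s i \<otimes>\<^bsub>P\<^esub> s j"
| "edge_to_cover ZGen = \<alpha>"

lemma edge_to_cover_closed: "edge_to_cover \<in> edge_gens E \<rightarrow> carrier P"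
  using adj_bounds by (force simp: edge_gens_def)

lemmas eval_simps = P.word_eval_append[OF edge_to_cover_closed]
  P.word_eval_pow[OF edge_to_cover_closed]

lemma eval_z: "word_eval P edge_to_cover (gen ZGen) = \<alpha>"
  by (simp add: P.word_eval_gen)

lemma eval_edge_word:
  assumes "adj i j"
  shows "word_eval P edge_to_cover (edge_word i j) = s i \<otimes>\<^bsub>P\<^esub> s j"
  using adj_bounds[OF assms]
  by (auto simp: edge_word_def P.word_eval_gen P.inv_mult_group s_inv)

lemma eval_walk:
  "successively adj vs \<Longrightarrow> vs \<noteq> [] \<Longrightarrow> set vs \<subseteq> {..<n} \<Longrightarrow>
    word_eval P edge_to_cover (concat (map2 edge_word vs (tl vs))) = s (hd vs) \<otimes>\<^bsub>P\<^esub> s (last vs)"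
proof (induction vs rule: induct_list012)
  case (3 v w vs)
  have adj: "adj v w" and walk: "successively adj (w # vs)" using "3.prems" by auto
  have b: "v < n" "w < n" "last (w # vs) < n"
    using "3.prems"(3) last_in_set[of "w # vs"] by auto
  have "word_eval P edge_to_cover (concat (map2 edge_word (v # w # vs) (tl (v # w # vs))))
      = (s v \<otimes>\<^bsub>P\<^esub> s w) \<otimes>\<^bsub>P\<^esub> word_eval P edge_to_cover (concat (map2 edge_word (w # vs) (tl (w # vs))))"
    using adj edge_class_walk[OF walk] by (simp add: eval_simps eval_edge_word)
  also have "\<dots> = (s v \<otimes>\<^bsub>P\<^esub> s w) \<otimes>\<^bsub>P\<^esub> (s w \<otimes>\<^bsub>P\<^esub> s (last (w # vs)))"
    using "3.IH"(2)[OF walk] "3.prems"(3) by simp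
  also have "\<dots> = s v \<otimes>\<^bsub>P\<^esub> s (last (w # vs))"
    using b by (intro s_cancel) auto
  finally show ?case by simp
qed (auto simp: s_square)

text \<open>Each of \<open>s\<^sub>i\<close>, \<open>s\<^sub>j\<close> commutes with \<open>s\<^sub>k s\<^sub>l\<close> already, since it passes both factors at the cost of
  \<open>\<alpha>\<^sup>2 = 1\<close>.\<close>

lemma not_connected_commute:
  assumes "adj i j" "adj k l" "not_connected E {i, j} {k, l}"
  shows "(s i \<otimes>\<^bsub>P\<^esub> s j) \<otimes>\<^bsub>P\<^esub> (s k \<otimes>\<^bsub>P\<^esub> s l) = (s k \<otimes>\<^bsub>P\<^esub> s l) \<otimes>\<^bsub>P\<^esub> (s i \<otimes>\<^bsub>P\<^esub> s j)"
proof -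
  note b = adj_bounds[OF assms(1)] adj_bounds[OF assms(2)]
  have one: "s v \<otimes>\<^bsub>P\<^esub> (s k \<otimes>\<^bsub>P\<^esub> s l) = (s k \<otimes>\<^bsub>P\<^esub> s l) \<otimes>\<^bsub>P\<^esub> s v" if v: "v \<in> {i, j}" for v
  proof (rule P.commute_of_two_swaps)
    have "v < n" "v \<noteq> k" "v \<noteq> l" "\<not> adj v k" "\<not> adj v l"
      using v b assms(3) by (auto simp: not_connected_def)
    then show "s v \<otimes>\<^bsub>P\<^esub> s k = \<alpha> \<otimes>\<^bsub>P\<^esub> s k \<otimes>\<^bsub>P\<^esub> s v" "s v \<otimes>\<^bsub>P\<^esub> s l = \<alpha> \<otimes>\<^bsub>P\<^esub> s l \<otimes>\<^bsub>P\<^esub> s v"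
      using b by (intro s_swap; simp)+
  qed (use v b \<alpha>_square \<alpha>_comm in auto)
  let ?c = "s k \<otimes>\<^bsub>P\<^esub> s l"
  have "(s i \<otimes>\<^bsub>P\<^esub> s j) \<otimes>\<^bsub>P\<^esub> ?c = s i \<otimes>\<^bsub>P\<^esub> (s j \<otimes>\<^bsub>P\<^esub> ?c)"
    using b by (intro P.m_assoc) auto
  also have "\<dots> = (s i \<otimes>\<^bsub>P\<^esub> ?c) \<otimes>\<^bsub>P\<^esub> s j"
    using b one[of j] by (simp add: P.m_assoc)
  also have "\<dots> = ?c \<otimes>\<^bsub>P\<^esub> (s i \<otimes>\<^bsub>P\<^esub> s j)"
    using b one[of i] by (simp add: P.m_assoc)
  finally show ?thesis .
qed

lemma edge_rels_cases:
  assumes "(u, v) \<in> edge_rels m E"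
  obtains
      (power) i j k where "i < j" "adj i j" "m i j = enat k"
        "u = word_pow (edge_word i j) k" "v = word_pow (gen ZGen) (k - 1)"
    | (cycle) vs where "graph_cycle E vs" "u = concat (map2 edge_word vs (rotate1 vs))" "v = []"
    | (two) i j k where "adj i j" "adj j k" "i < k" "m i k = 2"
        "u = word_pow (edge_word i j @ edge_word j k) 2" "v = gen ZGen"
    | (three) i j k l where "adj i j" "adj j k" "adj k l" "i < l" "m i l = 2"
        "u = word_pow (edge_word i j @ edge_word j k @ edge_word k l) 2" "v = gen ZGen"
    | (commute) i j k l where "adj i j" "adj k l" "not_connected E {i, j} {k, l}"
        "u = edge_word i j @ edge_word k l" "v = edge_word k l @ edge_word i j"
    | (central) i j where "i < j" "adj i j"
        "u = gen ZGen @ edge_word i j" "v = edge_word i j @ gen ZGen"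
    | (z_square) "u = word_pow (gen ZGen) 2" "v = []"
  using assms unfolding edge_rels_def Un_iff mem_Collect_eq singleton_iff prod.inject
  by - (elim disjE exE conjE; (rule that; assumption))

lemma edge_to_cover_rels:
  assumes "(u, v) \<in> edge_rels m E"
  shows "word_eval P edge_to_cover u = word_eval P edge_to_cover v"
proof -
  note eval = eval_simps eval_z eval_edge_word
  from assms show ?thesis
  proof (cases rule: edge_rels_cases)
    case (power i j k)
    then show ?thesis using adj_bounds[OF power(2)] by (simp add: eval s_power)
  next
    case (cycle vs)
    let ?ws = "vs @ [hd vs]"
    have ne: "vs \<noteq> []" using cycle(1) by (auto simp: graph_cycle_def)
    have edges: "adj a b" if "(a, b) \<in> set (zip ?ws (tl ?ws))" for a b
      using that cycle(1) by (auto simp: graph_cycle_def zip_rotate1)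
    have walk: "successively adj ?ws"
      using edges by (auto simp: successively_iff_zip_tl)
    have "set vs \<subseteq> {..<n}"
    proof
      fix a assume "a \<in> set vs"
      then have "a \<in> fst ` set (zip vs (rotate1 vs))"
        by (simp flip: set_map)
      then show "a \<in> {..<n}" using edges adj_bounds by (force simp: zip_rotate1)
    qed
    then have sub: "set ?ws \<subseteq> {..<n}" using hd_in_set[OF ne] by auto
    show ?thesis
      using eval_walk[OF walk _ sub] ne sub by (simp add: cycle zip_rotate1 s_square)
  next
    case (two i j k)
    note b = adj_bounds[OF two(1)] adj_bounds[OF two(2)]
    have "m i k = enat 2" using two(4) by (simp add: numeral_eq_enat)
    then show ?thesis
      using two(1,2) b s_power[of i k 2] by (simp add: two(5,6) eval s_cancel)
  next
    case (three i j k l)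
    note b = adj_bounds[OF three(1)] adj_bounds[OF three(2)] adj_bounds[OF three(3)]
    have "m i l = enat 2" using three(5) by (simp add: numeral_eq_enat)
    then show ?thesis
      using three(1,2,3) b s_power[of i l 2] by (simp add: three(6,7) eval s_cancel)
  next
    case (commute i j k l)
    then show ?thesis
      using not_connected_commute[OF commute(1,2,3)] by (simp only: eval edge_word_in)
  next
    case (central i j)
    note b = adj_bounds[OF central(2)]
    have "\<alpha> \<otimes>\<^bsub>P\<^esub> (s i \<otimes>\<^bsub>P\<^esub> s j) = s i \<otimes>\<^bsub>P\<^esub> (\<alpha> \<otimes>\<^bsub>P\<^esub> s j)"
      using b \<alpha>_comm[of i] by (simp add: P.m_assoc[symmetric])
    also have "\<dots> = (s i \<otimes>\<^bsub>P\<^esub> s j) \<otimes>\<^bsub>P\<^esub> \<alpha>"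
      using b \<alpha>_comm[of j] by (simp add: P.m_assoc)
    finally show ?thesis using central(2) by (simp add: central(3,4) eval)
  next
    case z_square
    then show ?thesis using \<alpha>_square by (simp add: eval numeral_2_eq_2)
  qed
qed


abbreviation \<Phi> :: "edge_generator word set \<Rightarrow> cover_generator word set" where
  "\<Phi> \<equiv> pres_hom P edge_to_cover"

lemma \<Phi>_hom: "\<Phi> \<in> hom Q P"
  unfolding edge_group_def by (rule P.pres_hom_hom[OF edge_to_cover_closed edge_to_cover_rels])

lemma \<Phi>_class: "w \<in> words (edge_gens E) \<Longrightarrow> \<Phi> (edge_class w) = word_eval P edge_to_cover w"
  by (rule P.pres_hom_class[OF edge_to_cover_closed edge_to_cover_rels])

section \<open>Injectivity\<close>

abbreviation W :: "(edge_generator word set \<times> edge_generator word set \<times> bool) monoid" where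
  "W \<equiv> wreath_two Q"

sublocale W: group W
  by (rule Q.wreath_two_group)

fun cover_to_wreath ::
    "cover_generator \<Rightarrow> edge_generator word set \<times> edge_generator word set \<times> bool" where
  "cover_to_wreath (STilde i) = (pot i, inv\<^bsub>Q\<^esub> pot i, True)"
| "cover_to_wreath Alpha = (z, z, False)"

lemma wreath_carrier: "(a, b, e) \<in> carrier W \<longleftrightarrow> a \<in> carrier Q \<and> b \<in> carrier Q"
  by (simp add: wreath_two_def)

lemma wreath_one: "\<one>\<^bsub>W\<^esub> = (\<one>\<^bsub>Q\<^esub>, \<one>\<^bsub>Q\<^esub>, False)"
  by (simp add: wreath_two_def)

lemma wreath_mult_simps:
  "(a, b, True) \<otimes>\<^bsub>W\<^esub> (c, d, f) = (a \<otimes>\<^bsub>Q\<^esub> d, b \<otimes>\<^bsub>Q\<^esub> c, \<not> f)"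
  "(a, b, False) \<otimes>\<^bsub>W\<^esub> (c, d, f) = (a \<otimes>\<^bsub>Q\<^esub> c, b \<otimes>\<^bsub>Q\<^esub> d, f)"
  by (simp_all add: wreath_two_def)

lemma cover_to_wreath_closed: "cover_to_wreath \<in> cover_gens n \<rightarrow> carrier W"
  by (auto simp: cover_gens_def wreath_carrier)

lemma cover_to_wreath_rels:
  assumes "(u, v) \<in> cover_rels n m"
  shows "word_eval W cover_to_wreath u = word_eval W cover_to_wreath v"
proof -
  note eval_append = W.word_eval_append[OF cover_to_wreath_closed]
    and eval_pow = W.word_eval_pow[OF cover_to_wreath_closed]
  have eval_s: "word_eval W cover_to_wreath (gen (STilde i)) = (pot i, inv\<^bsub>Q\<^esub> pot i, True)"
    if "i < n" for i
    using that by (simp add: W.word_eval_gen wreath_carrier)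
  have eval_\<alpha>: "word_eval W cover_to_wreath (gen Alpha) = (z, z, False)"
    by (simp add: W.word_eval_gen wreath_carrier)
  have power: "word_eval W cover_to_wreath (word_pow (gen (STilde i) @ gen (STilde j)) k)
      = (if even k then (z, z, False) else \<one>\<^bsub>W\<^esub>)"
    if "i < n" "j < n" "m i j = enat k" for i j k
  proof -
    have k: "1 \<le> k" using exponent_pos that by blast
    have "word_eval W cover_to_wreath (word_pow (gen (STilde i) @ gen (STilde j)) k)
        = (pot i \<otimes>\<^bsub>Q\<^esub> inv\<^bsub>Q\<^esub> pot j, \<rho> i j, False) [^]\<^bsub>W\<^esub> k"
      using that by (simp add: eval_pow eval_append eval_s wreath_mult_simps)
    also have "\<dots> = (z [^]\<^bsub>Q\<^esub> (k - 1), z [^]\<^bsub>Q\<^esub> (k - 1), False)"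
      using that by (simp add: Q.wreath_two_diag_pow \<rho>_power_conj \<rho>_power)
    finally show ?thesis
      using k by (simp add: Q.involution_pow[OF _ z_square] wreath_one)
  qed
  have "word_eval W cover_to_wreath (gen Alpha @ gen (STilde i))
      = word_eval W cover_to_wreath (gen (STilde i) @ gen Alpha)" if "i < n" for i
    using that by (simp add: eval_append eval_s eval_\<alpha> wreath_mult_simps z_central)
  moreover have "word_eval W cover_to_wreath (word_pow (gen Alpha) 2) = \<one>\<^bsub>W\<^esub>"
    by (simp add: eval_pow eval_\<alpha> Q.wreath_two_diag_pow Q.involution_pow[OF _ z_square] wreath_one)
  ultimately show ?thesis
    using assms unfolding cover_rels_def by (auto simp: power eval_\<alpha>)
qed

abbreviation \<Psi> ::
    "cover_generator word set \<Rightarrow> edge_generator word set \<times> edge_generator word set \<times> bool" where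
  "\<Psi> \<equiv> pres_hom W cover_to_wreath"

sublocale \<Psi>: group_hom P W \<Psi>
  by (intro group_hom.intro group_hom_axioms.intro P.is_group W.is_group)
     (unfold cover_group_def, rule W.pres_hom_hom[OF cover_to_wreath_closed cover_to_wreath_rels])

lemma \<Psi>_class: "w \<in> words (cover_gens n) \<Longrightarrow> \<Psi> (cover_class w) = word_eval W cover_to_wreath w"
  by (rule W.pres_hom_class[OF cover_to_wreath_closed cover_to_wreath_rels])

lemma \<Psi>_edge_to_cover:
  assumes "g \<in> edge_gens E"
  obtains u where "u \<in> carrier Q" "\<Psi> (edge_to_cover g) = (u, edge_class (gen g), False)"
proof (cases g)
  case (RTilde i j)
  then have e: "i < j" "adj i j" using assms by (auto simp: edge_gens_def)
  note b = adj_bounds[OF e(2)]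
  have s: "\<Psi> (s i) = (pot i, inv\<^bsub>Q\<^esub> pot i, True)" if "i < n" for i
    using that by (simp add: \<Psi>_class W.word_eval_gen wreath_carrier)
  have "\<Psi> (s i \<otimes>\<^bsub>P\<^esub> s j) = (pot i \<otimes>\<^bsub>Q\<^esub> inv\<^bsub>Q\<^esub> pot j, r i j, False)"
    using b e(2) by (simp add: s wreath_mult_simps r_pot)
  moreover have "r i j = edge_class (gen g)" using e(1) RTilde by (simp add: edge_word_def)
  ultimately show ?thesis using b RTilde by (intro that[of "pot i \<otimes>\<^bsub>Q\<^esub> inv\<^bsub>Q\<^esub> pot j"]) auto
next
  case ZGen
  then show ?thesis
    by (intro that[of z]) (simp_all add: \<Psi>_class W.word_eval_gen wreath_carrier)
qed

lemma \<Psi>_\<Phi>: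
  assumes "w \<in> words (edge_gens E)"
  shows "\<exists>u\<in>carrier Q. \<Psi> (word_eval P edge_to_cover w) = (u, edge_class w, False)"
  using assms
proof (induction w)
  case Nil
  then show ?case by (auto simp: wreath_one edge_class_Nil)
next
  case (Cons a w)
  obtain g b where a: "a = (g, b)" by force
  have g: "g \<in> edge_gens E" and w: "w \<in> words (edge_gens E)" using Cons.prems a by auto
  have cl: "edge_to_cover g \<in> carrier P" using edge_to_cover_closed g by blast
  have gen: "gen g \<in> words (edge_gens E)" using g by (simp add: gen_def)
  let ?l = "if b then edge_to_cover g else inv\<^bsub>P\<^esub> edge_to_cover g"
  obtain t where t: "t \<in> carrier Q" "\<Psi> (edge_to_cover g) = (t, edge_class (gen g), False)"
    using \<Psi>_edge_to_cover[OF g] .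
  have "\<exists>t\<in>carrier Q. \<Psi> ?l = (t, edge_class [(g, b)], False)"
  proof (cases b)
    case True
    then show ?thesis using t by (auto simp: gen_def)
  next
    case False
    have "\<Psi> ?l = (inv\<^bsub>Q\<^esub> t, inv\<^bsub>Q\<^esub> edge_class (gen g), False)"
      using False cl t gen by (simp add: \<Psi>.hom_inv Q.wreath_two_diag_inv)
    then show ?thesis
      using False t(1) edge_class_inv_gen[OF g, of True] by (auto simp: gen_def)
  qed
  then obtain t where t: "t \<in> carrier Q" "\<Psi> ?l = (t, edge_class [(g, b)], False)" by blast
  obtain u where u: "u \<in> carrier Q" "\<Psi> (word_eval P edge_to_cover w) = (u, edge_class w, False)"
    using Cons.IH[OF w] by blast
  have "\<Psi> (word_eval P edge_to_cover (a # w)) = \<Psi> ?l \<otimes>\<^bsub>W\<^esub> \<Psi> (word_eval P edge_to_cover w)"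
    unfolding a word_eval.simps
    using cl P.word_eval_closed[OF edge_to_cover_closed w] by (intro \<Psi>.hom_mult) auto
  also have "\<dots> = (t \<otimes>\<^bsub>Q\<^esub> u, edge_class (a # w), False)"
    using t u g w edge_class_append[of "[(g, b)]" w] a by (simp add: wreath_mult_simps)
  finally show ?case using t(1) u(1) by blast
qed

lemma \<Phi>_inj: "inj_on \<Phi> (carrier Q)"
proof (rule inj_onI)
  fix p q assume "p \<in> carrier Q" "q \<in> carrier Q" and eq: "\<Phi> p = \<Phi> q"
  then obtain v w where v: "v \<in> words (edge_gens E)" "p = edge_class v"
    and w: "w \<in> words (edge_gens E)" "q = edge_class w"
    using edge_group_cases by metis
  show "p = q"
    using \<Psi>_\<Phi>[OF v(1)] \<Psi>_\<Phi>[OF w(1)] eq unfolding v(2) w(2) \<Phi>_class[OF v(1)] \<Phi>_class[OF w(1)] by auto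
qed

section \<open>The image\<close>

definition cover_sign :: "cover_generator word set \<Rightarrow> int" where
  "cover_sign q = coxeter_sign (cover_proj n m q)"

lemma cover_sign_mult:
  assumes "p \<in> carrier P" "q \<in> carrier P"
  shows "cover_sign (p \<otimes>\<^bsub>P\<^esub> q) = cover_sign p * cover_sign q"
proof -
  note proj = cover_proj_hom[OF matrix]
  have "cover_sign (p \<otimes>\<^bsub>P\<^esub> q) = cover_sign p \<otimes>\<^bsub>sign_img\<^esub> cover_sign q"
    unfolding cover_sign_def hom_mult[OF proj assms]
    by (rule hom_mult[OF coxeter_sign_hom hom_in_carrier[OF proj] hom_in_carrier[OF proj]]) fact+
  then show ?thesis by (simp add: sign_img_def)
qed

lemma cover_sign_s: "i < n \<Longrightarrow> cover_sign (s i) = - 1"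
  by (simp add: cover_sign_def cover_proj_generators(1)[OF matrix] coxeter_sign_gen)

lemma cover_sign_\<alpha>: "cover_sign \<alpha> = 1"
  using hom_one[OF coxeter_sign_hom[of n m] coxeter_group_group sign_img_is_group]
  by (simp add: cover_sign_def cover_proj_generators(2)[OF matrix] sign_img_def)

lemma cover_alternating_carrier:
  "carrier (cover_alternating n m) = {q \<in> carrier P. cover_sign q = 1}"
  using hom_in_carrier[OF cover_proj_hom[OF matrix]]
  by (auto simp: cover_alternating_def alternating_subgroup_def kernel_def cover_sign_def sign_img_def)

lemma \<Phi>_even:
  assumes "q \<in> carrier Q"
  shows "\<Phi> q \<in> carrier (cover_alternating n m)"
proof -
  have one: "cover_sign \<one>\<^bsub>P\<^esub> = 1"
    using cover_sign_mult[of \<alpha> \<alpha>] \<alpha>_square cover_sign_\<alpha> by simp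
  have "cover_sign (word_eval P edge_to_cover w) = 1" if "w \<in> words (edge_gens E)" for w
    using that
  proof (induction w)
    case (Cons a w)
    obtain g b where a: "a = (g, b)" by force
    have g: "g \<in> edge_gens E" and w: "w \<in> words (edge_gens E)" using Cons.prems a by auto
    have cl: "edge_to_cover g \<in> carrier P" using edge_to_cover_closed g by blast
    have pos: "cover_sign (edge_to_cover g) = 1"
    proof (cases g)
      case (RTilde i j)
      then have "i < n" "j < n" using g adj_bounds by (auto simp: edge_gens_def)
      then show ?thesis using RTilde by (simp add: cover_sign_mult cover_sign_s)
    qed (simp add: cover_sign_\<alpha>)
    have "cover_sign (inv\<^bsub>P\<^esub> edge_to_cover g) = 1"
      using cover_sign_mult[of "edge_to_cover g" "inv\<^bsub>P\<^esub> edge_to_cover g"] cl pos one by simp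
    then show ?case
      using pos cl P.word_eval_closed[OF edge_to_cover_closed w] Cons.IH[OF w]
      by (simp add: a cover_sign_mult)
  qed (simp add: one)
  moreover obtain w where "w \<in> words (edge_gens E)" "q = edge_class w"
    using edge_group_cases[OF assms] .
  ultimately show ?thesis
    using P.word_eval_closed[OF edge_to_cover_closed]
    by (simp add: cover_alternating_carrier \<Phi>_class)
qed

sublocale \<Phi>: group_hom Q P \<Phi>
  by (intro group_hom.intro group_hom_axioms.intro P.is_group Q.is_group \<Phi>_hom)

lemma \<alpha>_in_image: "\<alpha> \<in> \<Phi> ` carrier Q"
  using \<Phi>_class[of "gen ZGen"] eval_z by (intro image_eqI[of _ _ z]) auto

lemma image_mult: "p \<in> \<Phi> ` carrier Q \<Longrightarrow> q \<in> \<Phi> ` carrier Q \<Longrightarrow> p \<otimes>\<^bsub>P\<^esub> q \<in> \<Phi> ` carrier Q"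
  using subgroup.m_closed[OF \<Phi>.img_is_subgroup] .

lemma s_pair_in_image:
  assumes "i < n" "j < n"
  shows "s i \<otimes>\<^bsub>P\<^esub> s j \<in> \<Phi> ` carrier Q"
  using connected[OF assms]
proof (induction rule: rtranclp_induct)
  case base
  then show ?case
    using assms subgroup.one_closed[OF \<Phi>.img_is_subgroup] by (simp add: s_square)
next
  case (step j k)
  note b = adj_bounds[OF step(2)]
  have "s j \<otimes>\<^bsub>P\<^esub> s k \<in> \<Phi> ` carrier Q"
    using \<Phi>_class[of "edge_word j k"] eval_edge_word[OF step(2)] step(2)
    by (intro image_eqI[of _ _ "r j k"]) auto
  then have "(s i \<otimes>\<^bsub>P\<^esub> s j) \<otimes>\<^bsub>P\<^esub> (s j \<otimes>\<^bsub>P\<^esub> s k) \<in> \<Phi> ` carrier Q"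
    using step.IH by (rule image_mult[rotated])
  then show ?case using assms b by (simp add: s_cancel)
qed

text \<open>By induction on the word: prefixing a letter \<open>s\<^sub>i\<close> flips the sign, and \<open>s\<^sub>i q\<close> lies in the image
  or in a coset of it because \<open>s\<^sub>i (s\<^sub>i q) = q\<close> and \<open>s\<^sub>i q = (s\<^sub>i s\<^sub>j) (s\<^sub>j q)\<close>. Letting \<open>j\<close> depend on the
  word makes the statement meaningful also when there are no vertices.\<close>

lemma image_or_coset:
  assumes "w \<in> words (cover_gens n)"
  shows "cover_sign (cover_class w) = 1 \<and> cover_class w \<in> \<Phi> ` carrier Q \<or>
    cover_sign (cover_class w) = - 1 \<and> (\<exists>j<n. s j \<otimes>\<^bsub>P\<^esub> cover_class w \<in> \<Phi> ` carrier Q)"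
  using assms
proof (induction w)
  case Nil
  have "cover_sign \<one>\<^bsub>P\<^esub> = 1" using cover_sign_mult[of \<alpha> \<alpha>] \<alpha>_square cover_sign_\<alpha> by simp
  then show ?case
    using subgroup.one_closed[OF \<Phi>.img_is_subgroup] by (simp add: cover_class_Nil)
next
  case (Cons a w)
  obtain g b where a: "a = (g, b)" by force
  have g: "g \<in> cover_gens n" and w: "w \<in> words (cover_gens n)" using Cons.prems a by auto
  let ?q = "cover_class w"
  \<comment> \<open>All generators of \<open>P\<close> are involutions, so inverse letters can be ignored.\<close>
  have involutive: "cover_class [(g, b)] = cover_class (gen g)"
  proof (cases b)
    case False
    have sq: "cover_class (gen g) \<otimes>\<^bsub>P\<^esub> cover_class (gen g) = \<one>\<^bsub>P\<^esub>"
      using g \<alpha>_square s_square by (auto simp: cover_gens_def)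
    have "cover_class [(g, False)] \<otimes>\<^bsub>P\<^esub> cover_class (gen g) = cover_class [(g, False), (g, True)]"
      using g cover_class_append[of "[(g, False)]" "gen g"] by (simp add: gen_def)
    also have "\<dots> = cover_class (gen g) \<otimes>\<^bsub>P\<^esub> cover_class (gen g)"
      unfolding sq cover_class_Nil[symmetric]
      using pres_eq_cancel[OF g, where R = "cover_rels n m" and b = False]
      by (intro word_class_eq) simp
    finally show ?thesis using False g by (simp add: gen_def)
  qed (simp add: gen_def)
  have aw: "cover_class (a # w) = cover_class (gen g) \<otimes>\<^bsub>P\<^esub> ?q"
    using cover_class_append[of "[(g, b)]" w] g w a involutive by simp
  show ?case
  proof (cases g)
    case Alpha
    have "s j \<otimes>\<^bsub>P\<^esub> (\<alpha> \<otimes>\<^bsub>P\<^esub> ?q) = \<alpha> \<otimes>\<^bsub>P\<^esub> (s j \<otimes>\<^bsub>P\<^esub> ?q)" if "j < n" for j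
      using that w \<alpha>_comm[OF that] by (simp add: P.m_assoc[symmetric])
    then show ?thesis
      using Cons.IH[OF w] w Alpha image_mult[OF \<alpha>_in_image]
      by (auto simp: aw cover_sign_mult cover_sign_\<alpha>)
  next
    case (STilde i)
    then have i: "i < n" using g by (auto simp: cover_gens_def)
    have sgn: "cover_sign (cover_class (a # w)) = - cover_sign ?q"
      using i w STilde by (simp add: aw cover_sign_mult cover_sign_s)
    from Cons.IH[OF w] show ?thesis
    proof (elim disjE conjE exE)
      assume "cover_sign ?q = 1" "?q \<in> \<Phi> ` carrier Q"
      moreover have "s i \<otimes>\<^bsub>P\<^esub> (s i \<otimes>\<^bsub>P\<^esub> ?q) = ?q"
        using i w by (simp add: P.m_assoc[symmetric] s_square)
      ultimately show ?thesis using sgn i by (auto simp: aw STilde)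
    next
      fix j assume j: "cover_sign ?q = - 1" "j < n" "s j \<otimes>\<^bsub>P\<^esub> ?q \<in> \<Phi> ` carrier Q"
      have "(s i \<otimes>\<^bsub>P\<^esub> s j) \<otimes>\<^bsub>P\<^esub> (s j \<otimes>\<^bsub>P\<^esub> ?q) \<in> \<Phi> ` carrier Q"
        by (rule image_mult[OF s_pair_in_image[OF i j(2)] j(3)])
      then show ?thesis using sgn i j w by (simp add: s_cancel aw STilde)
    qed
  qed
qed

lemma \<Phi>_image: "\<Phi> ` carrier Q = carrier (cover_alternating n m)"
proof
  show "\<Phi> ` carrier Q \<subseteq> carrier (cover_alternating n m)" using \<Phi>_even by blast
  show "carrier (cover_alternating n m) \<subseteq> \<Phi> ` carrier Q"
  proof
    fix q assume "q \<in> carrier (cover_alternating n m)"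
    then have q: "q \<in> carrier P" "cover_sign q = 1" by (auto simp: cover_alternating_carrier)
    then obtain w where "w \<in> words (cover_gens n)" "q = cover_class w"
      by (auto simp: cover_group_def presented_group_def)
    then show "q \<in> \<Phi> ` carrier Q" using image_or_coset[of w] q(2) by auto
  qed
qed

lemma \<Phi>_iso: "\<Phi> \<in> iso Q (cover_alternating n m)"
proof (rule isoI)
  show "\<Phi> \<in> hom Q (cover_alternating n m)"
    using \<Phi>_even \<Phi>.hom_mult by (intro homI) (simp_all add: cover_alternating_def)
  show "bij_betw \<Phi> (carrier Q) (carrier (cover_alternating n m))"
    using \<Phi>_inj \<Phi>_image by (simp add: bij_betw_def)
qed

end

section \<open>The presentation\<close>

theorem proposition3p2:
  fixes n :: nat and m :: "nat \<Rightarrow> nat \<Rightarrow> enat" and E :: "nat set set"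
  assumes "coxeter_matrix n m"
    and "connected_extension n m E"
  shows "cover_alternating n m \<cong> edge_group m E"
proof -
  interpret extended_coxeter_graph n m E
    using assms by unfold_locales
  have "edge_group m E \<cong> cover_alternating n m"
    using \<Phi>_iso by (auto simp: is_iso_def)
  then show ?thesis by (rule Q.iso_sym)
qed

end
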